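(* Fix $T>0$. For $t\in[0,T]$ let $X_t$ denote a Banach space with norm $\|\cdot\|_{X,t}$ such that for all $s>t$, $X_s\hookrightarrow X_t$ and $\|\cdot\|_{X,t}\le\|\cdot\|_{X,s}$. Suppose that $(\Psi^n)$ is a sequence of processes $\Psi^n:\Omega\to X_T$ such that $\|\Psi^n\|_{X,\cdot}$ is adapted and $\mathbb{P}$-a.s. continuous, $\Psi^n\in L^2(\Omega;X_T)$, and $\sup_n\|\Psi^n\|_{X,0}\in L^\infty(\Omega;\mathbb{R})$. For any given $M>1$ define the stopping times $$\tau^{M,T}_n:=T\wedge\inf\{s\ge0:\|\Psi^n\|^2_{X,s}\ge M+\|\Psi^n\|^2_{X,0}\}.$$ Suppose furthermore that (for every $M>1$) $$\lim_{m\to\infty}\sup_{n\ge m}\mathbb{E}\Big[\|\Psi^n-\Psi^m\|^2_{X,\tau^{M,T}_m\wedge\tau^{M,T}_n}\Big]=0$$ and that for any stopping time $\gamma$ and any sequence of stopping times $(\delta_j)$ converging to $0$ $\mathbb{P}$-a.s., $$\lim_{j\to\infty}\sup_{n\in\mathbb{N}}\mathbb{E}\Big(\|\Psi^n\|^2_{X,(\gamma+\delta_j)\wedge\tau^{M,T}_n}-\|\Psi^n\|^2_{X,\gamma\wedge\tau^{M,T}_n}\Big)=0.$$ Then there exist a stopping time $\tau^{M,T}_\infty$, a process $\Psi:\Omega\to X_{\tau^{M,T}_\infty}$ for which $\|\Psi\|_{X,\cdot\wedge\tau^{M,T}_\infty}$ is adapted and $\mathbb{P}$-a.s. continuous, and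 a subsequence indexed by $(m_j)$ such that (i) $\tau^{M,T}_\infty\le\tau^{M,T}_{m_j}$ $\mathbb{P}$-a.s.; (ii) $\lim_{j\to\infty}\|\Psi-\Psi^{m_j}\|_{X,\tau^{M,T}_\infty}=0$ $\mathbb{P}$-a.s. Moreover, for any $R>0$ we can choose $M$ such that the stopping time $$\tau^{R,T}:=T\wedge\inf\{s\ge0:\|\Psi\|^2_{X,s\wedge\tau^{M,T}_\infty}\ge R\}$$ satisfies $\tau^{R,T}\le\tau^{M,T}_\infty$ $\mathbb{P}$-a.s. Thus $\tau^{R,T}$ is simply $T\wedge\inf\{s\ge0:\|\Psi\|^2_{X,s}\ge R\}$.
   Context: $(\Omega,\mathcal{F},(\mathcal{F}_t)_{t\ge0},\mathbb{P})$ is a fixed filtered probability space, complete with respect to $\mathcal{F}_0$. For $s>t$, elements of $X_s$ are regarded as elements of $X_t$ through the given map $X_s\hookrightarrow X_t$ (the model case is restriction of functions of time on $[0,s]$ to $[0,t]$), so $\|x\|_{X,t}$ is defined and non-decreasing in $t\in[0,s]$ for $x\in X_s$. The notation $\Psi:\Omega\to X_{\tau}$ for a random time $\tau$ means $\Psi(\omega)\in X_{\tau(\omega)}$ for ($\mathbb P$-a.e.) $\omega$, and $\|\Psi\|_{X,\tau}$ is the random variable $\omega\mapsto\|\Psi(\omega)\|_{X,\tau(\omega)}$. The objects $\tau^{M,T}_\infty$, $\Psi$ and $(m_j)$ may depend on $M$.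
   Formalization: Item (i) for every j is incompatible with the "Moreover" part; together with that part, (i) is claimed only a.s. for all sufficiently large j (threshold depending on ω), while (i) for every j is claimed separately, for a possibly different stopping time and limit process. *)

theory Defs
  imports "HOL-Probability.Probability"
begin

text \<open>
  The spaces \<open>X t\<close> are linear subspaces of one ambient real vector space, each with its own norm
  \<open>nrm t\<close> (constrained on \<open>X t\<close> only). This loses no generality: any family of vector spaces sits
  in its direct sum.
\<close>

definition banach_on :: "'a::real_vector set \<Rightarrow> ('a \<Rightarrow> real) \<Rightarrow> bool" where
  "banach_on V N \<longleftrightarrow>
     subspace V
   \<and> (\<forall>x\<in>V. 0 \<le> N x \<and> (N x = 0 \<longleftrightarrow> x = 0))
   \<and> (\<forall>x\<in>V. \<forall>c. N (c *\<^sub>R x) = \<bar>c\<bar> * N x)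
   \<and> (\<forall>x\<in>V. \<forall>y\<in>V. N (x + y) \<le> N x + N y)
   \<and> (\<forall>u. (\<forall>k. u k \<in> V) \<and> (\<forall>e>0. \<exists>K::nat. \<forall>i\<ge>K. \<forall>j\<ge>K. N (u i - u j) < e)
          \<longrightarrow> (\<exists>x\<in>V. (\<lambda>k. N (u k - x)) \<longlonglongrightarrow> 0))"

text \<open>
  \<open>res s t\<close> is the given map from \<open>X s\<close> to \<open>X t\<close> for \<open>t \<le> s\<close>. It is not required to be injective:
  restriction of functions from \<open>[0,s]\<close> to \<open>[0,t]\<close> is not.
\<close>

locale banach_scale =
  fixes T :: real
    and X :: "real \<Rightarrow> 'a::real_vector set"
    and nrm :: "real \<Rightarrow> 'a \<Rightarrow> real"
    and res :: "real \<Rightarrow> real \<Rightarrow> 'a \<Rightarrow> 'a"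
  assumes banach: "\<And>t. 0 \<le> t \<Longrightarrow> t \<le> T \<Longrightarrow> banach_on (X t) (nrm t)"
    and res_in: "\<And>s t x. 0 \<le> t \<Longrightarrow> t \<le> s \<Longrightarrow> s \<le> T \<Longrightarrow> x \<in> X s \<Longrightarrow> res s t x \<in> X t"
    and res_add: "\<And>s t x y. 0 \<le> t \<Longrightarrow> t \<le> s \<Longrightarrow> s \<le> T \<Longrightarrow> x \<in> X s \<Longrightarrow> y \<in> X s
                    \<Longrightarrow> res s t (x + y) = res s t x + res s t y"
    and res_scaleR: "\<And>s t c x. 0 \<le> t \<Longrightarrow> t \<le> s \<Longrightarrow> s \<le> T \<Longrightarrow> x \<in> X s
                    \<Longrightarrow> res s t (c *\<^sub>R x) = c *\<^sub>R res s t x"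
    and res_refl: "\<And>t x. 0 \<le> t \<Longrightarrow> t \<le> T \<Longrightarrow> x \<in> X t \<Longrightarrow> res t t x = x"
    and res_trans: "\<And>s t r x. 0 \<le> r \<Longrightarrow> r \<le> t \<Longrightarrow> t \<le> s \<Longrightarrow> s \<le> T \<Longrightarrow> x \<in> X s
                    \<Longrightarrow> res t r (res s t x) = res s r x"
    and nrm_res_le: "\<And>s t x. 0 \<le> t \<Longrightarrow> t \<le> s \<Longrightarrow> s \<le> T \<Longrightarrow> x \<in> X s \<Longrightarrow> nrm t (res s t x) \<le> nrm s x"

text \<open>For \<open>x \<in> X s\<close> and \<open>t \<le> s\<close>, \<open>rnorm nrm res s t x\<close> is the norm of \<open>x\<close> regarded as an element
  of \<open>X t\<close>.\<close>

definition rnorm :: "(real \<Rightarrow> 'a \<Rightarrow> real) \<Rightarrow> (real \<Rightarrow> real \<Rightarrow> 'a \<Rightarrow> 'a) \<Rightarrow> real \<Rightarrow> real \<Rightarrow> 'a \<Rightarrow> real" where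
  "rnorm nrm res s t x = nrm t (res s t x)"

text \<open>
  The library's filtrations and real-valued stopping times are indexed by all of \<open>real\<close>. As stopping
  times are required to be nonnegative below, \<open>F t\<close> for \<open>t < 0\<close> plays no role; a filtration on
  \<open>[0,\<infinity>)\<close> is extended by \<open>F 0\<close>.
\<close>

definition complete_filtered_prob_space :: "'w measure \<Rightarrow> (real \<Rightarrow> 'w measure) \<Rightarrow> bool" where
  "complete_filtered_prob_space P F \<longleftrightarrow>
     prob_space P \<and> filtration (space P) F \<and> (\<forall>t. sets (F t) \<subseteq> sets P)
   \<and> complete_measure P \<and> null_sets P \<subseteq> sets (F 0)"

definition nonneg_stopping_time :: "'w measure \<Rightarrow> (real \<Rightarrow> 'w measure) \<Rightarrow> ('w \<Rightarrow> real) \<Rightarrow> bool" where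
  "nonneg_stopping_time P F \<tau> \<longleftrightarrow> (\<forall>\<omega>\<in>space P. 0 \<le> \<tau> \<omega>) \<and> stopping_time F \<tau>"

text \<open>\<open>L\<^sup>2(\<Omega>; V)\<close> in the Bochner sense: strongly measurable with square-integrable norm.\<close>

definition bochner_L2 :: "'w measure \<Rightarrow> 'a::real_vector set \<Rightarrow> ('a \<Rightarrow> real) \<Rightarrow> ('w \<Rightarrow> 'a) \<Rightarrow> bool" where
  "bochner_L2 P V N f \<longleftrightarrow>
     (AE \<omega> in P. f \<omega> \<in> V)
   \<and> (\<exists>u. (\<forall>k::nat. simple_function P (u k) \<and> u k ` space P \<subseteq> V)
         \<and> (AE \<omega> in P. (\<lambda>k. N (u k \<omega> - f \<omega>)) \<longlonglongrightarrow> 0))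
   \<and> integrable P (\<lambda>\<omega>. (N (f \<omega>))\<^sup>2)"

text \<open>\<open>T \<and> inf A\<close> with \<open>inf {} = \<infinity>\<close>.\<close>

definition capped_inf :: "real \<Rightarrow> real set \<Rightarrow> real" where
  "capped_inf T A = Inf (insert T A)"

definition hit_time ::
  "real \<Rightarrow> (real \<Rightarrow> 'a \<Rightarrow> real) \<Rightarrow> (real \<Rightarrow> real \<Rightarrow> 'a \<Rightarrow> 'a) \<Rightarrow> (nat \<Rightarrow> 'w \<Rightarrow> 'a) \<Rightarrow> real \<Rightarrow> nat \<Rightarrow> 'w \<Rightarrow> real"
where
  "hit_time T nrm res \<Psi>n M n \<omega> =
     capped_inf T {s. 0 \<le> s \<and> s \<le> T \<and>
        (rnorm nrm res T s (\<Psi>n n \<omega>))\<^sup>2 \<ge> M + (rnorm nrm res T 0 (\<Psi>n n \<omega>))\<^sup>2}"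

text \<open>
  \<open>\<tau>\<close> is a \<open>[0,T]\<close>-valued stopping time, \<open>\<Psi>\<close> takes values in \<open>X (\<tau> \<omega>)\<close>, its stopped norm is
  adapted and a.s. continuous, and the subsequence along \<open>m\<close> converges to \<open>\<Psi>\<close> in \<open>X (\<tau> \<omega>)\<close>, a.s.
\<close>

definition limit_up_to ::
  "'w measure \<Rightarrow> (real \<Rightarrow> 'w measure) \<Rightarrow> real \<Rightarrow> (real \<Rightarrow> 'a::real_vector set) \<Rightarrow> (real \<Rightarrow> 'a \<Rightarrow> real)
   \<Rightarrow> (real \<Rightarrow> real \<Rightarrow> 'a \<Rightarrow> 'a) \<Rightarrow> (nat \<Rightarrow> 'w \<Rightarrow> 'a) \<Rightarrow> ('w \<Rightarrow> real) \<Rightarrow> ('w \<Rightarrow> 'a) \<Rightarrow> (nat \<Rightarrow> nat) \<Rightarrow> bool"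
where
  "limit_up_to P F T X nrm res \<Psi>n \<tau> \<Psi> m \<longleftrightarrow>
     nonneg_stopping_time P F \<tau> \<and> (\<forall>\<omega>\<in>space P. \<tau> \<omega> \<le> T)
   \<and> (AE \<omega> in P. \<Psi> \<omega> \<in> X (\<tau> \<omega>))
   \<and> (\<forall>t\<ge>0. (\<lambda>\<omega>. rnorm nrm res (\<tau> \<omega>) (min t (\<tau> \<omega>)) (\<Psi> \<omega>)) \<in> borel_measurable (F t))
   \<and> (AE \<omega> in P. continuous_on {0..} (\<lambda>t. rnorm nrm res (\<tau> \<omega>) (min t (\<tau> \<omega>)) (\<Psi> \<omega>)))
   \<and> strict_mono m
   \<and> (AE \<omega> in P. (\<lambda>j. nrm (\<tau> \<omega>) (\<Psi> \<omega> - res T (\<tau> \<omega>) (\<Psi>n (m j) \<omega>))) \<longlonglongrightarrow> 0)"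

text \<open>
  The comparison of \<open>\<tau>\<close> with the hitting times along the subsequence \<open>m\<close> is kept separate from
  \<open>limit_up_to\<close>. It cannot hold for every \<open>j\<close> together with \<open>\<tau>R \<le> \<tau>\<close>, where \<open>\<tau>R\<close> is the hitting
  time of level \<open>R\<close> by the squared norm of \<open>\<Psi>\<close>. Take \<open>T = 1\<close>, \<open>X t = C[0,t]\<close>, all \<open>F t\<close> equal to the
  Lebesgue sets of \<open>[0,1]\<close>, and \<open>\<Psi>n n \<omega> s = n * max 0 (s - 1/2)\<close> for \<open>\<omega> \<le> 1/n\<close>, zero otherwise. Then
  \<open>\<Psi> = 0\<close> a.s., so \<open>\<tau>R = 1\<close>, while each hitting time with large index is below 1 with positive
  probability. With \<open>\<tau>R \<le> \<tau>\<close> the comparison is therefore made a.s. for all sufficiently large \<open>j\<close>.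
\<close>

end

theory Submission
  imports Defs
begin

text \<open>
  Along a subsequence chosen so that the expectations in the Cauchy condition are at most \<open>8\<^sup>-\<^sup>j\<close>, Markov's
  inequality and Borel--Cantelli give almost surely
  \<open>\<parallel>\<Psi>\<^sup>j\<^sup>+\<^sup>1 - \<Psi>\<^sup>j\<parallel> \<le> 2\<^sup>-\<^sup>j\<close> in the norm at time \<open>\<tau>\<^sub>j \<and> \<tau>\<^sub>j\<^sub>+\<^sub>1\<close> for all large \<open>j\<close>. Hence the increasing
  continuous paths \<open>D\<^sub>j(t) = \<parallel>\<Psi>\<^sup>j\<parallel>\<^sub>t\<^sup>2 - \<parallel>\<Psi>\<^sup>j\<parallel>\<^sub>0\<^sup>2\<close> differ by summable errors until they reach \<open>M\<close>, so a path that is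
  still at a level strictly below \<open>M\<close> at some time forces all later paths to be below \<open>M\<close> there as well.
  Let \<open>\<tau>\<close> be the first time at which \<open>liminf D\<^sub>j \<ge> M - 1\<close>. It precedes \<open>\<tau>\<^sub>j\<close> for all large \<open>j\<close>, so \<open>\<Psi>\<^sup>j\<close> converges
  in the space at time \<open>\<tau>\<close>, and the norm of the limit is the uniform limit on \<open>[0,\<tau>]\<close> of the norms of \<open>\<Psi>\<^sup>j\<close>. Either \<open>\<tau> = T\<close>
  or the squared norm of the limit at \<open>\<tau>\<close> is at least \<open>M - 1\<close>, so \<open>M = R + 1\<close> suits the level \<open>R\<close>.

  The paths are monotone, hence for \<open>t < T\<close> each of these hitting times is at most \<open>t\<close> iff the level has been reached at
  time \<open>t\<close>; this makes them stopping times without right-continuity of the filtration.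
\<close>

section \<open>Stopping times of a complete filtration\<close>

text \<open>The exceptional set is null, and by completeness so is its part where \<open>Q'\<close>
  holds; both lie in \<open>F 0\<close>, hence in \<open>F t\<close>. This lets path properties that
  hold only almost surely enter adaptedness arguments.\<close>

lemma pred_AE_cong:
  assumes basis: "complete_filtered_prob_space P F" and "0 \<le> t"
    and Q: "Measurable.pred (F t) Q" and AE: "AE \<omega> in P. Q \<omega> \<longleftrightarrow> Q' \<omega>"
  shows "Measurable.pred (F t) Q'"
proof -
  interpret complete_measure P using basis by (simp add: complete_filtered_prob_space_def)
  interpret filtration "space P" F using basis by (simp add: complete_filtered_prob_space_def)
  have null: "N \<in> sets (F t)" if "N \<in> null_sets P" for N
    using that basis sets_F_mono[OF \<open>0 \<le> t\<close>] by (auto simp: complete_filtered_prob_space_def)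
  define N where "N = {\<omega>\<in>space P. \<not> (Q \<omega> \<longleftrightarrow> Q' \<omega>)}"
  have N: "N \<in> null_sets P" using AE by (simp add: AE_iff_null_sets N_def)
  have "N \<in> sets (F t)" using N by (rule null)
  moreover have "{\<omega>\<in>N. Q' \<omega>} \<in> sets (F t)"
    by (rule null, rule complete2[OF _ N]) auto
  moreover have "{\<omega>\<in>space P. Q \<omega>} \<in> sets (F t)" using Q by (simp add: pred_def space_F)
  moreover have "{\<omega>\<in>space P. Q' \<omega>} = ({\<omega>\<in>space P. Q \<omega>} - N) \<union> {\<omega>\<in>N. Q' \<omega>}"
    by (auto simp: N_def)
  ultimately show ?thesis by (auto simp: pred_def space_F)
qed

lemma capped_inf_nonneg:
  assumes "0 \<le> T" "\<And>s. s \<in> A \<Longrightarrow> 0 \<le> s"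
  shows "0 \<le> capped_inf T A"
  unfolding capped_inf_def using assms by (intro cInf_greatest) auto

lemma capped_inf_lower:
  assumes "\<And>s. s \<in> A \<Longrightarrow> (0::real) \<le> s" "s \<in> insert T A"
  shows "capped_inf T A \<le> s"
  unfolding capped_inf_def using assms
  by (intro cInf_lower) (auto intro!: bdd_belowI[of _ "min 0 T"] intro: min.coboundedI1)

lemma capped_inf_less:
  assumes "capped_inf T A < u" "u \<le> T"
  shows "\<exists>s\<in>A. s < u"
  using cInf_lessD[of "insert T A" u] assms by (auto simp: capped_inf_def)

lemma capped_inf_closed:
  assumes "closed A" "\<And>s. s \<in> A \<Longrightarrow> (0::real) \<le> s"
  shows "capped_inf T A \<in> insert T A"
  unfolding capped_inf_def using assms
  by (intro closed_contains_Inf) (auto intro!: bdd_belowI[of _ "min 0 T"] intro: min.coboundedI1)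

text \<open>An infimum at most \<open>t\<close> yields \<open>A s\<close> only for
  \<open>s > t\<close>; \<open>right\<close> carries this to \<open>t\<close> itself and so stands
  in for right-continuity of the filtration. The bound \<open>t < T\<close> excludes times at which
  the cap alone gives the inequality.\<close>

lemma capped_inf_le_iff:
  assumes t: "0 \<le> t" "t < T"
    and up: "\<And>s u. 0 \<le> s \<Longrightarrow> s \<le> u \<Longrightarrow> u \<le> T \<Longrightarrow> A s \<Longrightarrow> A u"
    and right: "(\<And>s. t < s \<Longrightarrow> s \<le> T \<Longrightarrow> A s) \<Longrightarrow> A t"
  shows "capped_inf T {s. 0 \<le> s \<and> A s} \<le> t \<longleftrightarrow> A t"
proof
  assume le: "capped_inf T {s. 0 \<le> s \<and> A s} \<le> t"
  show "A t"
  proof (rule right)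
    fix s assume "t < s" "s \<le> T"
    then obtain u where "0 \<le> u" "A u" "u < s"
      using capped_inf_less[of T "{s. 0 \<le> s \<and> A s}" s] le by auto
    then show "A s" using up[of u s] \<open>s \<le> T\<close> by auto
  qed
next
  assume "A t" then show "capped_inf T {s. 0 \<le> s \<and> A s} \<le> t"
    using t by (intro capped_inf_lower) auto
qed

text \<open>For \<open>0 \<le> t < T\<close> the event that the capped infimum is at most
  \<open>t\<close> agrees almost surely with \<open>A t\<close>. For \<open>t < 0\<close> it is
  empty, and for \<open>t \<ge> T\<close> it is the whole space because of the cap.\<close>

lemma nonneg_stopping_time_capped_inf:
  assumes basis: "complete_filtered_prob_space P F" and T: "0 < T"
    and up: "AE \<omega> in P. \<forall>s u. 0 \<le> s \<longrightarrow> s \<le> u \<longrightarrow> u \<le> T \<longrightarrow> A s \<omega> \<longrightarrow> A u \<omega>"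
    and right: "AE \<omega> in P. \<forall>t. 0 \<le> t \<longrightarrow> t < T \<longrightarrow> (\<forall>s. t < s \<longrightarrow> s \<le> T \<longrightarrow> A s \<omega>) \<longrightarrow> A t \<omega>"
    and meas: "\<And>t. 0 \<le> t \<Longrightarrow> t < T \<Longrightarrow> Measurable.pred (F t) (A t)"
  shows "nonneg_stopping_time P F (\<lambda>\<omega>. capped_inf T {s. 0 \<le> s \<and> A s \<omega>})"
proof -
  let ?\<tau> = "\<lambda>\<omega>. capped_inf T {s. 0 \<le> s \<and> A s \<omega>}"
  have nn: "0 \<le> ?\<tau> \<omega>" for \<omega> using T by (intro capped_inf_nonneg) auto
  have "Measurable.pred (F t) (\<lambda>\<omega>. ?\<tau> \<omega> \<le> t)" for t
  proof -
    consider "t < 0" | "T \<le> t" | "0 \<le> t" "t < T" by linarith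
    then show ?thesis
    proof cases
      case 1
      then have "(\<lambda>\<omega>. ?\<tau> \<omega> \<le> t) = (\<lambda>\<omega>. False)" using nn by (auto simp: fun_eq_iff not_le intro: less_le_trans)
      then show ?thesis by simp
    next
      case 2
      have "?\<tau> \<omega> \<le> T" for \<omega> by (intro capped_inf_lower) auto
      then have "(\<lambda>\<omega>. ?\<tau> \<omega> \<le> t) = (\<lambda>\<omega>. True)" using 2 by (auto simp: fun_eq_iff intro: order_trans)
      then show ?thesis by simp
    next
      case 3
      show ?thesis
      proof (rule pred_AE_cong[OF basis 3(1) meas[OF 3]])
        show "AE \<omega> in P. A t \<omega> \<longleftrightarrow> ?\<tau> \<omega> \<le> t"
          using up right
        proof eventually_elim
          case (elim \<omega>)
          show ?case
            using elim 3 by (subst capped_inf_le_iff) blast+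
        qed
      qed
    qed
  qed
  then show ?thesis using nn by (auto simp: nonneg_stopping_time_def stopping_time_def)
qed

lemma continuous_on_right_ge:
  fixes f :: "real \<Rightarrow> real"
  assumes "continuous_on {0..T} f" "0 \<le> t" "t < T" "\<And>s. t < s \<Longrightarrow> s \<le> T \<Longrightarrow> c \<le> f s"
  shows "c \<le> f t"
proof (rule continuous_ge_on_closure[of "{t<..T}" f])
  show "continuous_on (closure {t<..T}) f"
    using assms by (auto intro: continuous_on_subset[OF assms(1)])
qed (use assms in auto)

text \<open>A continuous increasing path exceeds \<open>x\<close> at
  \<open>min t (\<tau> \<omega>)\<close> iff it does so at time 0 or at some rational time that is
  below \<open>\<tau> \<omega>\<close> and at most \<open>t\<close>. At these times \<open>f\<close>
  agrees with the adapted \<open>g\<close>, so countably many events of \<open>F t\<close> describe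
  the superlevel set.\<close>

lemma measurable_stopped_monotone:
  fixes f g :: "real \<Rightarrow> 'w \<Rightarrow> real"
  assumes basis: "complete_filtered_prob_space P F" and \<tau>: "nonneg_stopping_time P F \<tau>" and t: "0 \<le> t"
    and mono: "AE \<omega> in P. \<forall>s u. 0 \<le> s \<longrightarrow> s \<le> u \<longrightarrow> u \<le> \<tau> \<omega> \<longrightarrow> f s \<omega> \<le> f u \<omega>"
    and cont: "AE \<omega> in P. continuous_on {0..\<tau> \<omega>} (\<lambda>s. f s \<omega>)"
    and g: "\<And>s. 0 \<le> s \<Longrightarrow> s \<le> t \<Longrightarrow> g s \<in> borel_measurable (F s)"
    and fg: "AE \<omega> in P. \<forall>s. 0 \<le> s \<longrightarrow> s \<le> t \<longrightarrow> s \<le> \<tau> \<omega> \<longrightarrow> f s \<omega> = g s \<omega>"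
  shows "(\<lambda>\<omega>. f (min t (\<tau> \<omega>)) \<omega>) \<in> borel_measurable (F t)"
proof -
  interpret filtration "space P" F using basis by (simp add: complete_filtered_prob_space_def)
  have sub: "borel_measurable (F s) \<subseteq> borel_measurable (F t)" if "s \<le> t" for s
    using that by (intro measurable_mono) (auto simp: space_F sets_F_mono)
  have [measurable]: "Measurable.pred (F t) (\<lambda>\<omega>. x < f (min t (\<tau> \<omega>)) \<omega>)" for x
  proof (rule pred_AE_cong[OF basis t])
    \<comment> \<open>The strict inequality with \<open>\<tau> \<omega>\<close> makes the condition
      the complement of an event \<open>\<tau> \<le> q\<close> with \<open>q \<le> t\<close>. Time 0
      is listed separately because no such \<open>q\<close> exists when
      \<open>\<tau> \<omega> = 0\<close>.\<close>
    let ?Q = "\<lambda>\<omega>. x < g 0 \<omega> \<or> (\<exists>q::rat. 0 \<le> q \<and> of_rat q \<le> t \<and> of_rat q < \<tau> \<omega> \<and> x < g (of_rat q) \<omega>)"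
    have "Measurable.pred (F t) (\<lambda>\<omega>. 0 \<le> q \<and> of_rat q \<le> t \<and> of_rat q < \<tau> \<omega> \<and> x < g (of_rat q) \<omega>)"
      for q :: rat
    proof (cases "0 \<le> q \<and> of_rat q \<le> t")
      case True
      then have [measurable]: "g (of_rat q) \<in> borel_measurable (F t)"
        using sub g[of "of_rat q"] by auto
      have "Measurable.pred (F t) (\<lambda>\<omega>. \<not> \<tau> \<omega> \<le> of_rat q)"
        using stopping_time_le_const[of \<tau> "of_rat q" t] \<tau> True
        by (auto simp: nonneg_stopping_time_def)
      then have [measurable]: "Measurable.pred (F t) (\<lambda>\<omega>. of_rat q < \<tau> \<omega>)" by (simp add: not_le)
      show ?thesis by measurable
    next
      case False
      then have "(\<lambda>\<omega>. 0 \<le> q \<and> of_rat q \<le> t \<and> of_rat q < \<tau> \<omega> \<and> x < g (of_rat q) \<omega>) = (\<lambda>\<omega>. False)"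
        by blast
      then show ?thesis by simp
    qed
    moreover have [measurable]: "g 0 \<in> borel_measurable (F t)" using sub[OF t] g[of 0] t by auto
    ultimately show "Measurable.pred (F t) ?Q" by measurable
    show "AE \<omega> in P. ?Q \<omega> \<longleftrightarrow> x < f (min t (\<tau> \<omega>)) \<omega>"
      using mono cont fg AE_space
    proof eventually_elim
      case (elim \<omega>)
      have \<tau>0: "0 \<le> \<tau> \<omega>" using \<tau> elim by (auto simp: nonneg_stopping_time_def)
      let ?r = "min t (\<tau> \<omega>)"
      have le: "g s \<omega> \<le> f ?r \<omega>" if "0 \<le> s" "s \<le> ?r" for s
        using elim(1)[rule_format, of s ?r] elim(3)[rule_format, of s] that by auto
      show ?case
      proof
        assume "?Q \<omega>"
        then show "x < f ?r \<omega>"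
        proof (elim disjE exE conjE)
          fix q :: rat assume "0 \<le> q" "of_rat q \<le> t" "of_rat q < \<tau> \<omega>" "x < g (of_rat q) \<omega>"
          then show ?thesis using le[of "of_rat q"] by auto
        qed (use le[of 0] t \<tau>0 in auto)
      next
        assume x: "x < f ?r \<omega>"
        show "?Q \<omega>"
        proof (cases "?r = 0")
          case True
          then show ?thesis using x elim(3)[rule_format, of 0] t \<tau>0 by auto
        next
          case False
          then have r: "0 < ?r" using t \<tau>0 by linarith
          \<comment> \<open>Left continuity at \<open>?r\<close>: if the path stayed at most
            \<open>x\<close> strictly before \<open>?r\<close>, it would be at most \<open>x\<close>
            at \<open>?r\<close> too.\<close>
          have "\<exists>s. 0 \<le> s \<and> s < ?r \<and> x < f s \<omega>"
          proof (rule ccontr)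
            assume none: "\<not> ?thesis"
            have "f ?r \<omega> \<le> x"
            proof (rule continuous_le_on_closure[of "{0..<?r}" "\<lambda>s. f s \<omega>"])
              show "continuous_on (closure {0..<?r}) (\<lambda>s. f s \<omega>)"
                using r by (intro continuous_on_subset[OF elim(2)]) simp
              show "f s \<omega> \<le> x" if "s \<in> {0..<?r}" for s
                using none that by (meson atLeastLessThan_iff not_le)
            qed (use r in simp)
            then show False using x by simp
          qed
          then obtain s where s: "0 \<le> s" "s < ?r" "x < f s \<omega>" by auto
          obtain q where q: "s < of_rat q" "of_rat q < ?r"
            using of_rat_dense[OF s(2)] by auto
          then have q0: "(0::real) \<le> of_rat q" using s by linarith
          have "x < g (of_rat q) \<omega>"
            using elim(1)[rule_format, of s "of_rat q"] elim(3)[rule_format, of "of_rat q"] s q q0 by auto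
          then show ?thesis using q q0 by auto
        qed
      qed
    qed
  qed
  show ?thesis
    unfolding borel_measurable_iff_greater by (intro allI, fold pred_def) measurable
qed

section \<open>Monotone paths and their hitting times\<close>

text \<open>Successive paths stay within \<open>c 2\<^sup>-\<^sup>j\<close> of each other until one of them reaches \<open>M\<close>. If one path
  is still at the lower level \<open>b\<close>, where \<open>b\<close> is below \<open>M\<close> by more than the sum of the later errors, then no
  later path has reached \<open>M\<close>.\<close>

lemma common_time_before_hitting:
  fixes D :: "nat \<Rightarrow> real \<Rightarrow> real"
  assumes T: "0 < T" and M: "0 < M" "a < M" and c: "0 \<le> c"
    and D0: "\<And>j. D j 0 = 0"
    and mono: "\<And>j s t. 0 \<le> s \<Longrightarrow> s \<le> t \<Longrightarrow> t \<le> T \<Longrightarrow> D j s \<le> D j t"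
    and cont: "\<And>j. continuous_on {0..T} (D j)"
    and h: "\<And>j. h j = capped_inf T {s. 0 \<le> s \<and> s \<le> T \<and> M \<le> D j s}"
    and close: "\<And>j t. J \<le> j \<Longrightarrow> 0 \<le> t \<Longrightarrow> t \<le> h j \<Longrightarrow> t \<le> h (Suc j) \<Longrightarrow> \<bar>D (Suc j) t - D j t\<bar> \<le> c * (1/2)^j"
  obtains \<rho> k where "J \<le> k" "0 \<le> \<rho>" "\<rho> \<le> T" "\<And>l. k \<le> l \<Longrightarrow> \<rho> \<le> h l"
    "\<rho> = T \<or> (\<forall>l\<ge>k. a \<le> D l \<rho>)"
proof -
  have h_cases: "h j = T \<or> M \<le> D j (h j)" for j
  proof -
    let ?A = "{s. 0 \<le> s \<and> s \<le> T \<and> M \<le> D j s}"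
    have "?A = {0..T} \<inter> D j -` {M..}" by auto
    moreover have "closed ({0..T} \<inter> D j -` {M..})"
      by (intro continuous_closed_preimage cont) auto
    ultimately have "closed ?A" by (simp only:)
    then have "h j \<in> insert T ?A"
      unfolding h by (rule capped_inf_closed) simp
    then show ?thesis by blast
  qed
  have h_nn: "0 \<le> h j" for j unfolding h using T by (intro capped_inf_nonneg) auto
  \<comment> \<open>The level \<open>b\<close> lies strictly between \<open>a\<close> and
    \<open>M\<close>. As \<open>a\<close> may be negative, \<open>max 0 a\<close> ensures
    \<open>b \<ge> 0\<close>, so that a path starting at 0 can be followed up to level
    \<open>b\<close>.\<close>
  define b where "b = (max 0 a + M) / 2"
  have b: "0 \<le> b" "a < b" "b < M" using M by (auto simp: b_def)
  \<comment> \<open>An error of at most \<open>e\<close> around level \<open>b\<close> stays below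
    \<open>M\<close> by the first term and at or above \<open>a\<close> by the second.\<close>
  define e where "e = min ((M - b) / 2) (b - a)"
  have e: "0 < e" using b by (auto simp: e_def)
  have "(\<lambda>k. c * 2 * (1/2)^k) \<longlonglongrightarrow> c * 2 * 0"
    by (intro tendsto_mult LIMSEQ_realpow_zero tendsto_const) auto
  then have "\<forall>\<^sub>F k in sequentially. c * 2 * (1/2)^k < e"
    using e by (intro order_tendstoD) auto
  then have "\<forall>\<^sub>F k in sequentially. c * 2 * (1/2)^k < e \<and> J \<le> k"
    by (intro eventually_conj eventually_ge_at_top)
  then obtain k where k: "c * 2 * (1/2)^k < e" "J \<le> k"
    by (auto simp: eventually_sequentially)
  \<comment> \<open>Path \<open>k\<close> is the reference path: \<open>\<rho>\<close> is
    \<open>T\<close> if it ends at or below \<open>b\<close>, and otherwise a time at which it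
    equals \<open>b\<close>.\<close>
  obtain \<rho> where \<rho>: "0 \<le> \<rho>" "\<rho> \<le> T" "D k \<rho> \<le> b" "\<rho> = T \<or> D k \<rho> = b"
  proof (cases "D k T \<le> b")
    case True then show ?thesis using that[of T] T by auto
  next
    case False then show ?thesis using IVT'[of "D k" 0 b T] that D0 b T cont[of k] by force
  qed
  have Dk: "D k t \<le> b" if "0 \<le> t" "t \<le> \<rho>" for t using mono[of t \<rho> k] that \<rho> by auto
  \<comment> \<open>This is the sum of the errors \<open>c * (1/2)^i\<close> over
    \<open>k \<le> i < k + n\<close>; the full series is \<open>c * 2 * (1/2)^k\<close>, which
    \<open>k\<close> was chosen to make smaller than \<open>e\<close>.\<close>
  let ?S = "\<lambda>n. c * 2 * ((1/2)^k - (1/2)^(k+n))"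
  have S: "?S n \<le> e" for n
  proof -
    have "?S n \<le> c * 2 * (1/2)^k" using c by (intro mult_left_mono) auto
    then show ?thesis using k by linarith
  qed
  \<comment> \<open>The two claims need each other: closeness is available only up to both hitting
    times, and the next hitting time is located through closeness to the reference path.\<close>
  have main: "\<rho> \<le> h (k+n) \<and> (\<forall>t. 0 \<le> t \<longrightarrow> t \<le> \<rho> \<longrightarrow> \<bar>D (k+n) t - D k t\<bar> \<le> ?S n)" for n
  proof (induction n)
    case 0
    have "\<rho> \<le> h k"
    proof (rule ccontr)
      assume "\<not> ?thesis"
      then show False using h_cases[of k] Dk[of "h k"] h_nn[of k] b \<rho> by auto
    qed
    then show ?case by simp
  next
    case (Suc n)
    have step: "\<bar>D (Suc (k+n)) t - D k t\<bar> \<le> ?S (Suc n)" if t: "0 \<le> t" "t \<le> \<rho>" "t \<le> h (Suc (k+n))" for t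
    proof -
      have "\<bar>D (Suc (k+n)) t - D (k+n) t\<bar> \<le> c * (1/2)^(k+n)"
        using close[of "k+n" t] k t Suc by auto
      moreover have "\<bar>D (k+n) t - D k t\<bar> \<le> ?S n" using Suc t by auto
      ultimately show ?thesis by (simp add: algebra_simps)
    qed
    \<comment> \<open>Hitting before \<open>\<rho>\<close> would give a value of at least
      \<open>M\<close> within \<open>e\<close> of the reference path, which is at most
      \<open>b\<close> there; but \<open>b + e < M\<close>.\<close>
    have "\<rho> \<le> h (Suc (k+n))"
    proof (rule ccontr)
      let ?t = "h (Suc (k+n))"
      assume less: "\<not> ?thesis"
      then have "M \<le> D (Suc (k+n)) ?t" using h_cases[of "Suc (k+n)"] \<rho> by auto
      moreover have "\<bar>D (Suc (k+n)) ?t - D k ?t\<bar> \<le> e"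
        using step[of ?t] S[of "Suc n"] less h_nn by force
      moreover have "D k ?t \<le> b" using Dk less h_nn by auto
      moreover have "e < M - b" using b by (auto simp: e_def min_def)
      ultimately show False by linarith
    qed
    then show ?case using step by auto
  qed
  show ?thesis
  proof (rule that[of k \<rho>])
    show "\<rho> \<le> h l" if "k \<le> l" for l using main[of "l - k"] that by auto
    show "\<rho> = T \<or> (\<forall>l\<ge>k. a \<le> D l \<rho>)"
    proof (cases "\<rho> = T")
      case False
      have "a \<le> D l \<rho>" if "k \<le> l" for l
      proof -
        have "\<bar>D l \<rho> - D k \<rho>\<bar> \<le> e" 
          using main[of "l - k"] S[of "l-k"] that \<rho> by force
        moreover have "D k \<rho> = b" using \<rho> False by auto
        moreover have "e \<le> b - a" by (simp add: e_def)
        ultimately show ?thesis by linarith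
      qed
      then show ?thesis by auto
    qed simp
  qed (use k \<rho> in auto)
qed

section \<open>Limits in the scale of spaces\<close>

context banach_scale
begin

lemma
  assumes "0 \<le> t" "t \<le> T"
  shows subspace_X: "subspace (X t)"
    and nrm_nonneg: "x \<in> X t \<Longrightarrow> 0 \<le> nrm t x"
    and nrm_eq_zero: "x \<in> X t \<Longrightarrow> nrm t x = 0 \<longleftrightarrow> x = 0"
    and nrm_scaleR: "x \<in> X t \<Longrightarrow> nrm t (c *\<^sub>R x) = \<bar>c\<bar> * nrm t x"
    and nrm_triangle: "x \<in> X t \<Longrightarrow> y \<in> X t \<Longrightarrow> nrm t (x + y) \<le> nrm t x + nrm t y"
  using banach[OF assms] unfolding banach_on_def by blast+

lemma nrm_zero: "0 \<le> t \<Longrightarrow> t \<le> T \<Longrightarrow> nrm t 0 = 0"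
  using nrm_eq_zero[of t 0] subspace_0[OF subspace_X[of t]] by blast

lemma nrm_minus_commute:
  assumes "0 \<le> t" "t \<le> T" "x \<in> X t" "y \<in> X t"
  shows "nrm t (x - y) = nrm t (y - x)"
proof -
  have "nrm t ((-1) *\<^sub>R (y - x)) = \<bar>-1\<bar> * nrm t (y - x)"
    using assms by (intro nrm_scaleR subspace_diff subspace_X)
  then show ?thesis by simp
qed

lemma nrm_diff_triangle:
  assumes "0 \<le> t" "t \<le> T" "x \<in> X t" "y \<in> X t"
  shows "\<bar>nrm t x - nrm t y\<bar> \<le> nrm t (x - y)"
proof -
  have "nrm t ((x - y) + y) \<le> nrm t (x - y) + nrm t y" "nrm t ((y - x) + x) \<le> nrm t (y - x) + nrm t x"
    by (rule nrm_triangle[OF assms(1,2) subspace_diff[OF subspace_X[OF assms(1,2)]]]; fact assms)+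
  then show ?thesis using nrm_minus_commute[OF assms] by simp
qed

lemma res_diff:
  assumes "0 \<le> t" "t \<le> s" "s \<le> T" "x \<in> X s" "y \<in> X s"
  shows "res s t (x - y) = res s t x - res s t y"
proof -
  have "res s t ((-1) *\<^sub>R y) = (-1) *\<^sub>R res s t y"
    using assms by (intro res_scaleR)
  moreover have "(-1) *\<^sub>R y \<in> X s" using assms by (intro subspace_scale subspace_X) auto
  ultimately have "res s t (x + (-1) *\<^sub>R y) = res s t x + (-1) *\<^sub>R res s t y"
    using assms by (simp only: res_add)
  then show ?thesis by simp
qed

lemma rnorm_nonneg: "0 \<le> t \<Longrightarrow> t \<le> s \<Longrightarrow> s \<le> T \<Longrightarrow> x \<in> X s \<Longrightarrow> 0 \<le> rnorm nrm res s t x"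
  unfolding rnorm_def by (intro nrm_nonneg res_in) simp_all

lemma rnorm_mono:
  assumes "0 \<le> u" "u \<le> t" "t \<le> s" "s \<le> T" "x \<in> X s"
  shows "rnorm nrm res s u x \<le> rnorm nrm res s t x"
  using nrm_res_le[of u t "res s t x"] res_trans[of u t s x] res_in[of t s x] assms
  by (simp add: rnorm_def)

lemma rnorm_diff_triangle:
  assumes "0 \<le> t" "t \<le> s" "s \<le> T" "x \<in> X s" "y \<in> X s"
  shows "\<bar>rnorm nrm res s t x - rnorm nrm res s t y\<bar> \<le> rnorm nrm res s t (x - y)"
  using nrm_diff_triangle[of t "res s t x" "res s t y"] assms by (simp add: rnorm_def res_diff res_in)

text \<open>The maps \<open>res\<close> are linear and do not increase norms, and the difference at
  time \<open>r\<close> is the image of the difference at time \<open>s\<close>.\<close>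

lemma restrict_limit:
  assumes r: "0 \<le> r" "r \<le> s" "s \<le> T" and x: "\<And>j. x j \<in> X T" and y: "y \<in> X s"
    and lim: "(\<lambda>j. nrm s (y - res T s (x j))) \<longlonglongrightarrow> 0"
  shows "(\<lambda>j. nrm r (res s r y - res T r (x j))) \<longlonglongrightarrow> 0"
proof (rule tendsto_sandwich[OF _ _ tendsto_const lim])
  have in_s: "res T s (x j) \<in> X s" for j using r x by (intro res_in) auto
  have eq: "res s r y - res T r (x j) = res s r (y - res T s (x j))" for j
    using r x y in_s by (simp add: res_diff res_trans)
  have in_d: "y - res T s (x j) \<in> X s" for j
    using r y in_s by (intro subspace_diff subspace_X) auto
  show "\<forall>\<^sub>F j in sequentially. 0 \<le> nrm r (res s r y - res T r (x j))"
    unfolding eq using r in_d by (intro always_eventually allI nrm_nonneg res_in) auto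
  show "\<forall>\<^sub>F j in sequentially. nrm r (res s r y - res T r (x j)) \<le> nrm s (y - res T s (x j))"
    unfolding eq using r in_d by (intro always_eventually allI nrm_res_le) auto
qed

lemma rnorm_limit:
  assumes r: "0 \<le> r" "r \<le> s" "s \<le> T" and x: "\<And>j. x j \<in> X T" and y: "y \<in> X s"
    and lim: "(\<lambda>j. nrm s (y - res T s (x j))) \<longlonglongrightarrow> 0"
  shows "(\<lambda>j. rnorm nrm res T r (x j)) \<longlonglongrightarrow> rnorm nrm res s r y"
proof -
  have "(\<lambda>j. rnorm nrm res T r (x j) - rnorm nrm res s r y) \<longlonglongrightarrow> 0"
  proof (rule Lim_null_comparison[OF always_eventually restrict_limit[OF assms]], rule allI)
    fix j
    have "res s r y \<in> X r" "res T r (x j) \<in> X r" using r x y by (auto intro!: res_in)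
    then show "norm (rnorm nrm res T r (x j) - rnorm nrm res s r y) \<le> nrm r (res s r y - res T r (x j))"
      using nrm_diff_triangle[of r "res s r y" "res T r (x j)"] r
      by (auto simp: rnorm_def abs_minus_commute)
  qed
  then show ?thesis by (rule LIM_zero_cancel)
qed

text \<open>The norms at all \<open>t \<le> s\<close> differ by at most the single number
  \<open>nrm s (y - res T s (x j))\<close>, so the convergence of the norm paths is uniform.\<close>

lemma continuous_rnorm_limit:
  assumes s: "0 \<le> s" "s \<le> T" and x: "\<And>j. x j \<in> X T" and y: "y \<in> X s"
    and lim: "(\<lambda>j. nrm s (y - res T s (x j))) \<longlonglongrightarrow> 0"
    and cont: "\<And>j. continuous_on {0..T} (\<lambda>t. rnorm nrm res T t (x j))"
  shows "continuous_on {0..s} (\<lambda>t. rnorm nrm res s t y)"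
proof (rule uniform_limit_theorem)
  show "\<forall>\<^sub>F j in sequentially. continuous_on {0..s} (\<lambda>t. rnorm nrm res T t (x j))"
    using s by (auto intro!: always_eventually continuous_on_subset[OF cont])
  have in_s: "res T s (x j) \<in> X s" for j using s x by (intro res_in) auto
  show "uniform_limit {0..s} (\<lambda>j t. rnorm nrm res T t (x j)) (\<lambda>t. rnorm nrm res s t y) sequentially"
  proof (rule uniform_limitI)
    fix e :: real assume "0 < e"
    with lim have "\<forall>\<^sub>F j in sequentially. nrm s (y - res T s (x j)) < e"
      by (rule order_tendstoD)
    then show "\<forall>\<^sub>F j in sequentially. \<forall>t\<in>{0..s}. dist (rnorm nrm res T t (x j)) (rnorm nrm res s t y) < e"
    proof eventually_elim
      case (elim j)
      show ?case
      proof
        fix t assume t: "t \<in> {0..s}"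
        have "rnorm nrm res T t (x j) = rnorm nrm res s t (res T s (x j))"
          using t s x by (simp add: rnorm_def res_trans)
        then have "dist (rnorm nrm res T t (x j)) (rnorm nrm res s t y) \<le> rnorm nrm res s t (y - res T s (x j))"
          using rnorm_diff_triangle[of t s y "res T s (x j)"] t s y in_s by (simp add: dist_real_def abs_minus_commute)
        also have "\<dots> \<le> nrm s (y - res T s (x j))"
          unfolding rnorm_def using t s y in_s by (intro nrm_res_le subspace_diff subspace_X) auto
        finally show "dist (rnorm nrm res T t (x j)) (rnorm nrm res s t y) < e" using elim by simp
      qed
    qed
  qed
qed simp

lemma limit_exists:
  assumes r: "0 \<le> r" "r \<le> T" and x: "\<And>j. x j \<in> X T"
    and close: "\<And>j. J \<le> j \<Longrightarrow> rnorm nrm res T r (x (Suc j) - x j) \<le> (1/2)^j"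
  shows "\<exists>y\<in>X r. (\<lambda>j. nrm r (y - res T r (x j))) \<longlonglongrightarrow> 0"
proof -
  define u where "u j = res T r (x j)" for j
  have u: "u j \<in> X r" for j unfolding u_def using r x by (intro res_in) auto
  note diff = subspace_diff[OF subspace_X[OF r]]
  have step: "nrm r (u (Suc j) - u j) \<le> (1/2)^j" if "J \<le> j" for j
    using close[OF that] r x by (simp add: rnorm_def u_def res_diff)
  \<comment> \<open>The right-hand side is the geometric sum of \<open>(1/2)^i\<close> over
    \<open>j \<le> i < j + n\<close>.\<close>
  have far: "nrm r (u (j + n) - u j) \<le> 2 * ((1/2)^j - (1/2)^(j+n))" if "J \<le> j" for j n
  proof (induction n)
    case 0 then show ?case using nrm_zero[OF r] by simp
  next
    case (Suc n)
    have "nrm r ((u (Suc (j+n)) - u (j+n)) + (u (j+n) - u j)) \<le>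
        nrm r (u (Suc (j+n)) - u (j+n)) + nrm r (u (j+n) - u j)"
      using u r by (intro nrm_triangle diff)
    then show ?case using step[of "j+n"] Suc that by simp
  qed
  have cauchy: "\<forall>e>0. \<exists>K. \<forall>i\<ge>K. \<forall>j\<ge>K. nrm r (u i - u j) < e"
  proof (intro allI impI)
    fix e :: real assume e: "0 < e"
    \<comment> \<open>The factor 4 arises from comparing both members of a pair with
      \<open>u k\<close>, at a cost of \<open>2 * (1/2)^k\<close> each.\<close>
    have "(\<lambda>k. 4 * (1/2)^k :: real) \<longlonglongrightarrow> 4 * 0"
      by (intro tendsto_mult LIMSEQ_realpow_zero tendsto_const) auto
    then have "\<forall>\<^sub>F k in sequentially. 4 * (1/2)^k < e"
      using e by (intro order_tendstoD) auto
    then have "\<forall>\<^sub>F k in sequentially. 4 * (1/2)^k < e \<and> J \<le> k"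
      by (intro eventually_conj eventually_ge_at_top)
    then obtain k where k: "4 * (1/2)^k < e" "J \<le> k"
      by (auto simp: eventually_sequentially)
    have near: "nrm r (u i - u k) \<le> 2 * (1/2)^k" if "k \<le> i" for i
    proof -
      have "0 \<le> (1/2::real)^i" by simp
      moreover have "nrm r (u i - u k) \<le> 2 * ((1/2)^k - (1/2)^i)" using far[of k "i - k"] k that by simp
      ultimately show ?thesis by (simp only: right_diff_distrib)
    qed
    have "nrm r (u i - u j) < e" if "k \<le> i" "k \<le> j" for i j
    proof -
      have "nrm r ((u i - u k) + (u k - u j)) \<le> nrm r (u i - u k) + nrm r (u k - u j)"
        using u r by (intro nrm_triangle diff)
      moreover have "nrm r (u k - u j) = nrm r (u j - u k)" using u r by (intro nrm_minus_commute)
      ultimately show ?thesis using near[OF that(1)] near[OF that(2)] k by simp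
    qed
    then show "\<exists>K. \<forall>i\<ge>K. \<forall>j\<ge>K. nrm r (u i - u j) < e" by blast
  qed
  then obtain y where y: "y \<in> X r" "(\<lambda>k. nrm r (u k - y)) \<longlonglongrightarrow> 0"
  proof -
    have "\<exists>y\<in>X r. (\<lambda>k. nrm r (u k - y)) \<longlonglongrightarrow> 0"
      using banach[OF r, unfolded banach_on_def, THEN conjunct2, THEN conjunct2, THEN conjunct2, THEN conjunct2]
      by (rule allE[of _ u], elim mp) (intro conjI allI u cauchy)
    then show thesis using that by blast
  qed
  have "nrm r (u k - y) = nrm r (y - u k)" for k using u y r by (intro nrm_minus_commute)
  then show ?thesis using y unfolding u_def by auto
qed

text \<open>This is the deterministic content at one \<open>\<omega>\<close>, with \<open>x\<close>
  the values of the subsequence there. The first two conclusions are the path conditions of the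
  stopping time criterion. \<open>A\<close> is phrased with \<open>liminf\<close> because
  convergence is obtained only up to some time \<open>\<rho>\<close>, while \<open>A\<close> must
  make sense at every time.\<close>

lemma pathwise_limit:
  assumes T: "0 < T" and M: "1 < M" and x: "\<And>j. x j \<in> X T"
    and cont: "\<And>j. continuous_on {0..T} (\<lambda>t. rnorm nrm res T t (x j))"
    and K: "\<And>j. rnorm nrm res T 0 (x j) \<le> K"
    and h: "\<And>j. h j = capped_inf T {s. 0 \<le> s \<and> s \<le> T \<and>
        (rnorm nrm res T s (x j))\<^sup>2 \<ge> M + (rnorm nrm res T 0 (x j))\<^sup>2}"
    and close: "\<forall>j\<ge>J. rnorm nrm res T (min (h j) (h (Suc j))) (x (Suc j) - x j) \<le> (1/2)^j"
    and A: "\<And>s. A s \<longleftrightarrow> s \<le> T \<and> ereal (M - 1) \<le>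
        liminf (\<lambda>j. ereal ((rnorm nrm res T s (x j))\<^sup>2 - (rnorm nrm res T 0 (x j))\<^sup>2))"
    and \<tau>: "\<tau> = capped_inf T {s. 0 \<le> s \<and> A s}"
  shows "0 \<le> s \<Longrightarrow> s \<le> u \<Longrightarrow> u \<le> T \<Longrightarrow> A s \<Longrightarrow> A u"
    and "0 \<le> t \<Longrightarrow> t < T \<Longrightarrow> (\<And>s. t < s \<Longrightarrow> s \<le> T \<Longrightarrow> A s) \<Longrightarrow> A t"
    and "\<forall>\<^sub>F j in sequentially. \<tau> \<le> h j"
    and "\<exists>y\<in>X \<tau>. (\<lambda>j. nrm \<tau> (y - res T \<tau> (x j))) \<longlonglongrightarrow> 0"
    and "y \<in> X \<tau> \<Longrightarrow> (\<lambda>j. nrm \<tau> (y - res T \<tau> (x j))) \<longlonglongrightarrow> 0 \<Longrightarrow>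
        \<tau> = T \<or> M - 1 \<le> (rnorm nrm res \<tau> \<tau> y)\<^sup>2"
proof -
  define N where "N j t = rnorm nrm res T t (x j)" for j t
  define D where "D j t = (N j t)\<^sup>2 - (N j 0)\<^sup>2" for j t
  have A: "A s \<longleftrightarrow> s \<le> T \<and> ereal (M - 1) \<le> liminf (\<lambda>j. ereal (D j s))" for s
    unfolding A D_def N_def ..
  have h: "h j = capped_inf T {s. 0 \<le> s \<and> s \<le> T \<and> M \<le> D j s}" for j
    unfolding h D_def N_def by (simp add: algebra_simps)
  have h_bounds: "0 \<le> h j" "h j \<le> T" for j
    unfolding h using T by (auto intro!: capped_inf_nonneg capped_inf_lower)
  have N_nonneg: "0 \<le> N j t" if "0 \<le> t" "t \<le> T" for j t
    unfolding N_def using that x by (intro rnorm_nonneg) auto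
  have N_mono: "N j s \<le> N j t" if "0 \<le> s" "s \<le> t" "t \<le> T" for j s t
    unfolding N_def using that x by (intro rnorm_mono) auto
  have D_mono: "D j s \<le> D j t" if "0 \<le> s" "s \<le> t" "t \<le> T" for j s t
    unfolding D_def using N_mono[OF that] N_nonneg[of s j] that by (auto intro!: power_mono)
  have D_cont: "continuous_on {0..T} (D j)" for j
    unfolding D_def N_def by (intro continuous_intros cont)
  have D0: "D j 0 = 0" for j by (simp add: D_def)
  have D_le: "D j t \<le> M" if t: "0 \<le> t" "t \<le> h j" for j t
  proof (rule ccontr)
    assume less: "\<not> ?thesis"
    then obtain s where s: "0 \<le> s" "s \<le> t" "D j s = M"
      using IVT'[of "D j" 0 M t] t h_bounds[of j] D0 M continuous_on_subset[OF D_cont[of j], of "{0..t}"] by force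
    then have "h j \<le> s" unfolding h using t h_bounds(2)[of j] by (intro capped_inf_lower) auto
    then have "s = t" using s t by simp
    then show False using s less by simp
  qed
  \<comment> \<open>Before its hitting time a path gains at most \<open>M\<close> over its initial
    square, which is at most \<open>K\<^sup>2\<close>. The uniform \<open>K\<close> makes
    \<open>L\<close> independent of \<open>j\<close>, so closeness of norms becomes closeness of
    squares.\<close>
  define L where "L = sqrt (M + K\<^sup>2)"
  have N_le: "N j t \<le> L" if t: "0 \<le> t" "t \<le> h j" for j t
  proof -
    have "(N j 0)\<^sup>2 \<le> K\<^sup>2"
      using K[of j] N_nonneg[of 0 j] T by (intro power_mono) (auto simp: N_def)
    then have "(N j t)\<^sup>2 \<le> M + K\<^sup>2" using D_le[OF t] by (simp add: D_def)
    then show ?thesis unfolding L_def by (rule real_le_rsqrt)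
  qed
  have L: "0 \<le> L" using M by (simp add: L_def)
  have close_x: "rnorm nrm res T t (x (Suc j) - x j) \<le> (1/2)^j"
    if "J \<le> j" "0 \<le> t" "t \<le> h j" "t \<le> h (Suc j)" for j t
  proof -
    have "rnorm nrm res T t (x (Suc j) - x j) \<le> rnorm nrm res T (min (h j) (h (Suc j))) (x (Suc j) - x j)"
      using that h_bounds(2)[of j] x T by (intro rnorm_mono subspace_diff subspace_X) auto
    then show ?thesis using close that(1) by force
  qed
  have close_N: "\<bar>N (Suc j) t - N j t\<bar> \<le> (1/2)^j"
    if "J \<le> j" "0 \<le> t" "t \<le> h j" "t \<le> h (Suc j)" for j t
  proof -
    have "\<bar>N (Suc j) t - N j t\<bar> \<le> rnorm nrm res T t (x (Suc j) - x j)"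
      unfolding N_def using that h_bounds(2)[of j] x by (intro rnorm_diff_triangle) auto
    then show ?thesis using close_x[OF that] by simp
  qed
  have close_sq: "\<bar>(N (Suc j) t)\<^sup>2 - (N j t)\<^sup>2\<bar> \<le> 2 * L * (1/2)^j"
    if "J \<le> j" "0 \<le> t" "t \<le> h j" "t \<le> h (Suc j)" for j t
  proof -
    have "\<bar>(N (Suc j) t)\<^sup>2 - (N j t)\<^sup>2\<bar> = (N (Suc j) t + N j t) * \<bar>N (Suc j) t - N j t\<bar>"
      using N_nonneg[of t j] N_nonneg[of t "Suc j"] that h_bounds(2)[of j]
      by (simp add: power2_eq_square square_diff_square_factored abs_mult)
    also have "\<dots> \<le> (2 * L) * (1/2)^j"
      using close_N[OF that] N_le[of t j] N_le[of t "Suc j"] that L by (intro mult_mono) auto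
    finally show ?thesis .
  qed
  \<comment> \<open>Subtracting the initial squares adds a second error of size
    \<open>2 * L * (1/2)^j\<close>.\<close>
  have close_D: "\<bar>D (Suc j) t - D j t\<bar> \<le> (4 * L) * (1/2)^j"
    if "J \<le> j" "0 \<le> t" "t \<le> h j" "t \<le> h (Suc j)" for j t
    using close_sq[OF that] close_sq[OF that(1), of 0] h_bounds unfolding D_def by auto
  \<comment> \<open>With \<open>a = M - 1\<close>, the level used in \<open>A\<close>, either
    \<open>\<rho> = T\<close> or \<open>A \<rho>\<close> holds; in both cases
    \<open>\<tau> \<le> \<rho>\<close>.\<close>
  obtain \<rho> k where \<rho>: "J \<le> k" "0 \<le> \<rho>" "\<rho> \<le> T" "\<And>l. k \<le> l \<Longrightarrow> \<rho> \<le> h l"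
    "\<rho> = T \<or> (\<forall>l\<ge>k. M - 1 \<le> D l \<rho>)"
    by (rule common_time_before_hitting[OF T _ _ _ D0 D_mono D_cont h close_D, of "M - 1"]) (use M L in auto)
  obtain z where z: "z \<in> X \<rho>" "(\<lambda>j. nrm \<rho> (z - res T \<rho> (x j))) \<longlonglongrightarrow> 0"
    using limit_exists[of \<rho> x k] \<rho> x close_x by auto
  \<comment> \<open>On \<open>[0,\<rho>]\<close> the \<open>liminf\<close> is a genuine limit with
    continuous value \<open>g\<close>, so there \<open>A t\<close> just says
    \<open>M - 1 \<le> g t\<close>.\<close>
  define g where "g t = (rnorm nrm res \<rho> t z)\<^sup>2 - (rnorm nrm res \<rho> 0 z)\<^sup>2" for t
  have D_lim: "(\<lambda>j. D j t) \<longlonglongrightarrow> g t" if "0 \<le> t" "t \<le> \<rho>" for t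
    unfolding D_def N_def g_def
    using rnorm_limit[of t \<rho> x z] rnorm_limit[of 0 \<rho> x z] that \<rho> x z by (intro tendsto_intros) auto
  have A_g: "A t \<longleftrightarrow> M - 1 \<le> g t" if "0 \<le> t" "t \<le> \<rho>" for t
  proof -
    have "liminf (\<lambda>j. ereal (D j t)) = ereal (g t)"
      using D_lim[OF that] by (intro lim_imp_Liminf) auto
    then show ?thesis using that \<rho> by (simp add: A)
  qed
  have g_cont: "continuous_on {0..\<rho>} g"
    unfolding g_def by (intro continuous_intros continuous_rnorm_limit[OF \<rho>(2,3) x z cont])
  show up: "A u" if "0 \<le> s" "s \<le> u" "u \<le> T" "A s" for s u
  proof -
    have "liminf (\<lambda>j. ereal (D j s)) \<le> liminf (\<lambda>j. ereal (D j u))"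
      using D_mono[OF that(1-3)] by (intro Liminf_mono) auto
    moreover have "ereal (M - 1) \<le> liminf (\<lambda>j. ereal (D j s))" using that(4) by (simp add: A)
    ultimately show ?thesis using that(3) order_trans unfolding A by blast
  qed
  have A\<rho>: "A \<rho>" if "\<rho> < T"
  proof -
    have "\<forall>\<^sub>F l in sequentially. ereal (M - 1) \<le> ereal (D l \<rho>)"
      using \<rho> that by (auto simp: eventually_sequentially)
    then show ?thesis using \<rho> unfolding A by (auto intro: Liminf_bounded)
  qed
  \<comment> \<open>From \<open>\<rho>\<close> on, \<open>A \<rho>\<close> and monotonicity suffice;
    before \<open>\<rho>\<close>, continuity of \<open>g\<close> does.\<close>
  show right: "A t" if t: "0 \<le> t" "t < T" "\<And>s. t < s \<Longrightarrow> s \<le> T \<Longrightarrow> A s" for t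
  proof (cases "\<rho> \<le> t")
    case True
    then show ?thesis using A\<rho> up[of \<rho> t] t(1,2) \<rho>(2) by simp
  next
    case False
    have "M - 1 \<le> g t"
    proof (rule continuous_on_right_ge[OF g_cont t(1)])
      show "M - 1 \<le> g s" if "t < s" "s \<le> \<rho>" for s
        using A_g[of s] t(3)[of s] t(1) that \<rho>(3) by simp
    qed (use False in simp)
    then show ?thesis using A_g[of t] t(1) False by simp
  qed
  have \<tau>\<rho>: "\<tau> \<le> \<rho>"
  proof (cases "\<rho> = T")
    case True then show ?thesis unfolding \<tau> by (intro capped_inf_lower) simp_all
  next
    case False then show ?thesis unfolding \<tau> using A\<rho> \<rho>(2,3) by (intro capped_inf_lower) simp_all
  qed
  have \<tau>0: "0 \<le> \<tau>" unfolding \<tau> using T by (intro capped_inf_nonneg) auto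
  show "\<forall>\<^sub>F j in sequentially. \<tau> \<le> h j"
    using order_trans[OF \<tau>\<rho> \<rho>(4)] by (rule eventually_sequentiallyI)
  show "\<exists>y\<in>X \<tau>. (\<lambda>j. nrm \<tau> (y - res T \<tau> (x j))) \<longlonglongrightarrow> 0"
    using restrict_limit[OF \<tau>0 \<tau>\<rho> \<rho>(3) x z] res_in[OF \<tau>0 \<tau>\<rho> \<rho>(3) z(1)] by blast
  show "\<tau> = T \<or> M - 1 \<le> (rnorm nrm res \<tau> \<tau> y)\<^sup>2"
    if y: "y \<in> X \<tau>" "(\<lambda>j. nrm \<tau> (y - res T \<tau> (x j))) \<longlonglongrightarrow> 0" for y
  proof (cases "\<tau> < T")
    case True
    have "A \<tau>"
      using capped_inf_le_iff[OF \<tau>0 True, of A, OF up right[OF \<tau>0 True]] \<tau> by simp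
    then have "M - 1 \<le> g \<tau>" using A_g[OF \<tau>0 \<tau>\<rho>] by simp
    \<comment> \<open>The number \<open>g \<tau>\<close> was defined through \<open>z\<close>.
      Uniqueness of real limits expresses it through \<open>y\<close>, without identifying
      \<open>y\<close> with the restriction of \<open>z\<close>.\<close>
    moreover have "(\<lambda>j. D j \<tau>) \<longlonglongrightarrow> (rnorm nrm res \<tau> \<tau> y)\<^sup>2 - (rnorm nrm res \<tau> 0 y)\<^sup>2"
      unfolding D_def N_def
      using rnorm_limit[OF _ _ less_imp_le[OF True] x y] \<tau>0 by (intro tendsto_intros) simp_all
    then have "g \<tau> = (rnorm nrm res \<tau> \<tau> y)\<^sup>2 - (rnorm nrm res \<tau> 0 y)\<^sup>2"
      using D_lim[OF \<tau>0 \<tau>\<rho>] LIMSEQ_unique by blast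
    ultimately show ?thesis by (smt (verit) zero_le_power2)
  next
    case False
    then show ?thesis using \<tau>\<rho> \<rho>(3) by simp
  qed
qed

end

section \<open>Measurability and the fast subsequence\<close>

lemma borel_measurable_AE_cong:
  fixes f g :: "'w \<Rightarrow> real"
  assumes basis: "complete_filtered_prob_space P F" and t: "0 \<le> t"
    and f[measurable]: "f \<in> borel_measurable (F t)" and AE: "AE \<omega> in P. f \<omega> = g \<omega>"
  shows "g \<in> borel_measurable (F t)"
proof -
  have [measurable]: "Measurable.pred (F t) (\<lambda>\<omega>. x < g \<omega>)" for x
    by (rule pred_AE_cong[OF basis t, of "\<lambda>\<omega>. x < f \<omega>"]) (measurable, use AE in auto)
  show ?thesis
    unfolding borel_measurable_iff_greater by (intro allI, fold pred_def) measurable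
qed

lemma (in complete_measure) borel_measurable_AE_eq:
  fixes f g :: "'a \<Rightarrow> real"
  assumes f[measurable]: "f \<in> borel_measurable M" and AE: "AE x in M. f x = g x"
  shows "g \<in> borel_measurable M"
  unfolding borel_measurable_iff_greater
proof
  fix a
  show "{w \<in> space M. a < g w} \<in> sets M"
    by (rule in_sets_AE[of "{w \<in> space M. a < f w}"]) (use AE in auto)
qed

text \<open>Markov's inequality for the squares at threshold \<open>(1/4)^j\<close> gives
  probability at most \<open>(1/8)^j / (1/4)^j = (1/2)^j\<close>, which is summable.\<close>

lemma AE_eventually_le_half_power:
  fixes d :: "nat \<Rightarrow> 'w \<Rightarrow> real"
  assumes P: "prob_space P" and int: "\<And>j. integrable P (\<lambda>\<omega>. (d j \<omega>)\<^sup>2)"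
    and small: "\<And>j. (\<integral>\<omega>. (d j \<omega>)\<^sup>2 \<partial>P) \<le> (1/8)^j"
  shows "AE \<omega> in P. \<forall>\<^sub>F j in sequentially. d j \<omega> \<le> (1/2)^j"
proof -
  interpret prob_space P by fact
  define A where "A j = {\<omega> \<in> space P. (1/4)^j \<le> (d j \<omega>)\<^sup>2}" for j
  have A: "A j \<in> sets P" for j
    unfolding A_def using borel_measurable_integrable[OF int[of j]] by measurable
  have bound: "prob (A j) \<le> (1/2)^j" for j
  proof -
    have "prob (A j) \<le> (\<integral>\<omega>. (d j \<omega>)\<^sup>2 \<partial>P) / (1/4)^j"
      unfolding A_def by (rule integral_Markov_inequality_measure[OF int sets.empty_sets]) auto
    also have "\<dots> \<le> (1/8)^j / (1/4)^j" using small[of j] by (intro divide_right_mono) auto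
    also have "\<dots> = (1/2)^j" by (simp flip: power_divide)
    finally show ?thesis .
  qed
  have "summable (\<lambda>j. prob (A j))"
    by (rule summable_comparison_test'[of "\<lambda>j. (1/2)^j"]) (use bound in \<open>auto intro: summable_geometric\<close>)
  then have "AE \<omega> in P. \<forall>\<^sub>F j in sequentially. \<omega> \<in> space P - A j"
    by (intro borel_cantelli_AE1 A) (auto simp: less_top[symmetric])
  then show ?thesis
  proof eventually_elim
    case (elim \<omega>)
    then show ?case
    proof eventually_elim
      case (elim j)
      then have "(d j \<omega>)\<^sup>2 \<le> ((1/2)^j)\<^sup>2"
        by (auto simp: A_def power2_eq_square simp flip: power_mult_distrib)
      then show ?case by (rule power2_le_imp_le) simp
    qed
  qed
qed

lemma strict_mono_subsequence:
  fixes Q :: "nat \<Rightarrow> nat \<Rightarrow> bool"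
  assumes "\<And>j. \<forall>\<^sub>F n in sequentially. Q j n"
  obtains m where "strict_mono m" "\<And>j. Q j (m j)"
proof -
  have "\<forall>j. \<exists>N. \<forall>n\<ge>N. Q j n" using assms by (simp add: eventually_sequentially)
  then obtain f where f: "\<And>j n. f j \<le> n \<Longrightarrow> Q j n" by metis
  \<comment> \<open>The sum dominates \<open>f j\<close>, and the summand \<open>j\<close> makes the
    sequence strictly increasing.\<close>
  show thesis
  proof (rule that[of "\<lambda>j. j + (\<Sum>i\<le>j. f i)"])
    show "strict_mono (\<lambda>j. j + (\<Sum>i\<le>j. f i))" by (auto simp: strict_mono_Suc_iff)
    show "Q j (j + (\<Sum>i\<le>j. f i))" for j
      by (rule f) (auto intro: trans_le_add2 member_le_sum)
  qed
qed

section \<open>Norms at random times and restriction to time 0\<close>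

context banach_scale
begin

text \<open>For a fixed vector the norm is monotone in time, hence Borel, and can be composed with
  \<open>\<sigma>\<close>. Simple functions take finitely many vectors, and \<open>f\<close> is an
  almost sure limit of such functions in the largest norm \<open>nrm T\<close>.\<close>

lemma measurable_rnorm_random_time:
  assumes "complete_measure P" and T: "0 \<le> T"
    and f: "AE \<omega> in P. f \<omega> \<in> X T"
    and u: "\<And>k. simple_function P (u k)" "\<And>k. u k ` space P \<subseteq> X T"
    and lim: "AE \<omega> in P. (\<lambda>k. nrm T (u k \<omega> - f \<omega>)) \<longlonglongrightarrow> 0"
    and \<sigma>[measurable]: "\<sigma> \<in> borel_measurable P" and \<sigma>T: "\<And>\<omega>. \<omega> \<in> space P \<Longrightarrow> 0 \<le> \<sigma> \<omega> \<and> \<sigma> \<omega> \<le> T"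
  shows "(\<lambda>\<omega>. rnorm nrm res T (\<sigma> \<omega>) (f \<omega>)) \<in> borel_measurable P"
proof -
  interpret complete_measure P by fact
  have const: "(\<lambda>\<omega>. rnorm nrm res T (\<sigma> \<omega>) x) \<in> borel_measurable P" if x: "x \<in> X T" for x
  proof -
    \<comment> \<open>Clamping time to \<open>[0,T]\<close> gives a function monotone on the whole
      line, since the norms are constrained only on \<open>[0,T]\<close>.\<close>
    have "mono (\<lambda>t. rnorm nrm res T (max 0 (min T t)) x)"
      using x T by (intro monoI rnorm_mono) auto
    then have [measurable]: "(\<lambda>t. rnorm nrm res T (max 0 (min T t)) x) \<in> borel_measurable borel"
      by (rule borel_measurable_mono)
    have "(\<lambda>\<omega>. rnorm nrm res T (max 0 (min T (\<sigma> \<omega>))) x) \<in> borel_measurable P" by measurable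
    then show ?thesis
      by (rule measurable_cong[THEN iffD1, rotated]) (use \<sigma>T in \<open>simp add: min_absorb2 max_absorb2\<close>)
  qed
  have [measurable]: "(\<lambda>\<omega>. rnorm nrm res T (\<sigma> \<omega>) (u k \<omega>)) \<in> borel_measurable P" for k
  proof (rule measurable_compose_countable'[where I="u k ` space P"])
    show "u k \<in> P \<rightarrow>\<^sub>M count_space (u k ` space P)"
      using simple_functionD[OF u(1)[of k]] by (subst measurable_count_space_eq2) auto
    show "countable (u k ` space P)" using simple_functionD(1)[OF u(1)[of k]] by (rule countable_finite)
  qed (use const u(2) in auto)
  show ?thesis
  proof (rule borel_measurable_AE_eq)
    show "(\<lambda>\<omega>. lim (\<lambda>k. rnorm nrm res T (\<sigma> \<omega>) (u k \<omega>))) \<in> borel_measurable P" by measurable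
    show "AE \<omega> in P. lim (\<lambda>k. rnorm nrm res T (\<sigma> \<omega>) (u k \<omega>)) = rnorm nrm res T (\<sigma> \<omega>) (f \<omega>)"
      using f lim AE_space
    proof eventually_elim
      case (elim \<omega>)
      have u': "u k \<omega> \<in> X T" for k using u(2) elim(3) by auto
      note \<sigma>\<omega> = \<sigma>T[OF elim(3), THEN conjunct1] \<sigma>T[OF elim(3), THEN conjunct2]
      have "(\<lambda>k. rnorm nrm res T (\<sigma> \<omega>) (u k \<omega>) - rnorm nrm res T (\<sigma> \<omega>) (f \<omega>)) \<longlonglongrightarrow> 0"
      proof (rule Lim_null_comparison[OF always_eventually elim(2)], rule allI)
        fix k
        have "norm (rnorm nrm res T (\<sigma> \<omega>) (u k \<omega>) - rnorm nrm res T (\<sigma> \<omega>) (f \<omega>))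
            \<le> rnorm nrm res T (\<sigma> \<omega>) (u k \<omega> - f \<omega>)"
          using rnorm_diff_triangle[OF \<sigma>\<omega> order_refl u' elim(1)] by simp
        also have "\<dots> \<le> nrm T (u k \<omega> - f \<omega>)"
          unfolding rnorm_def using T by (intro nrm_res_le \<sigma>\<omega> subspace_diff subspace_X u' elim(1)) auto
        finally show "norm (rnorm nrm res T (\<sigma> \<omega>) (u k \<omega>) - rnorm nrm res T (\<sigma> \<omega>) (f \<omega>))
            \<le> nrm T (u k \<omega> - f \<omega>)" .
      qed
      then show ?case by (rule limI[OF LIM_zero_cancel])
    qed
  qed
qed

text \<open>Without this the Cauchy condition would be void: the integral of a non-integrable function is \<open>0\<close>.\<close>

lemma integrable_rnorm_diff:
  assumes P: "complete_measure P" and T: "0 \<le> T"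
    and f: "bochner_L2 P (X T) (nrm T) f" and g: "bochner_L2 P (X T) (nrm T) g"
    and \<sigma>: "\<sigma> \<in> borel_measurable P" "\<And>\<omega>. \<omega> \<in> space P \<Longrightarrow> 0 \<le> \<sigma> \<omega> \<and> \<sigma> \<omega> \<le> T"
  shows "integrable P (\<lambda>\<omega>. (rnorm nrm res T (\<sigma> \<omega>) (f \<omega> - g \<omega>))\<^sup>2)"
proof -
  have fu: "AE \<omega> in P. f \<omega> \<in> X T" "integrable P (\<lambda>\<omega>. (nrm T (f \<omega>))\<^sup>2)"
    using f by (simp_all add: bochner_L2_def)
  obtain u where u: "\<forall>k::nat. simple_function P (u k) \<and> u k ` space P \<subseteq> X T"
      "AE \<omega> in P. (\<lambda>k. nrm T (u k \<omega> - f \<omega>)) \<longlonglongrightarrow> 0"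
    using f unfolding bochner_L2_def by (elim conjE exE)
  have gv: "AE \<omega> in P. g \<omega> \<in> X T" "integrable P (\<lambda>\<omega>. (nrm T (g \<omega>))\<^sup>2)"
    using g by (simp_all add: bochner_L2_def)
  obtain v where v: "\<forall>k::nat. simple_function P (v k) \<and> v k ` space P \<subseteq> X T"
      "AE \<omega> in P. (\<lambda>k. nrm T (v k \<omega> - g \<omega>)) \<longlonglongrightarrow> 0"
    using g unfolding bochner_L2_def by (elim conjE exE)
  note diff = subspace_diff[OF subspace_X[OF T order_refl]]
  have dist_le: "nrm T (x - y) \<le> nrm T x + nrm T y" if "x \<in> X T" "y \<in> X T" for x y
  proof -
    have "nrm T (0 - y) = nrm T (y - 0)"
      using nrm_minus_commute[of T 0 y] T that subspace_0[OF subspace_X[OF T order_refl]] by simp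
    moreover have "nrm T (x + (0 - y)) \<le> nrm T x + nrm T (0 - y)"
      using T that subspace_0[OF subspace_X[OF T order_refl]] by (intro nrm_triangle diff) auto
    ultimately show ?thesis by simp
  qed
  have uv: "u k \<omega> \<in> X T" "v k \<omega> \<in> X T" if "\<omega> \<in> space P" for k \<omega>
    using u(1)[THEN spec, of k] v(1)[THEN spec, of k] that by blast+
  have [measurable]: "(\<lambda>\<omega>. rnorm nrm res T (\<sigma> \<omega>) (f \<omega> - g \<omega>)) \<in> borel_measurable P"
  proof (rule measurable_rnorm_random_time[where u="\<lambda>k \<omega>. u k \<omega> - v k \<omega>", OF P T _ _ _ _ \<sigma>])
    show "AE \<omega> in P. f \<omega> - g \<omega> \<in> X T" using fu(1) gv(1) by eventually_elim (rule diff)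
    show "simple_function P (\<lambda>\<omega>. u k \<omega> - v k \<omega>)" for k
      by (rule simple_function_compose2[OF u(1)[THEN spec, THEN conjunct1] v(1)[THEN spec, THEN conjunct1]])
    show "(\<lambda>\<omega>. u k \<omega> - v k \<omega>) ` space P \<subseteq> X T" for k
      using uv by (intro image_subsetI diff)
    show "AE \<omega> in P. (\<lambda>k. nrm T (u k \<omega> - v k \<omega> - (f \<omega> - g \<omega>))) \<longlonglongrightarrow> 0"
      using fu(1) u(2) gv(1) v(2) AE_space
    proof eventually_elim
      case (elim \<omega>)
      note uv = uv[OF elim(5)]
      have eq: "u k \<omega> - v k \<omega> - (f \<omega> - g \<omega>) = (u k \<omega> - f \<omega>) - (v k \<omega> - g \<omega>)" for k by simp
      have up: "nrm T (u k \<omega> - v k \<omega> - (f \<omega> - g \<omega>)) \<le> nrm T (u k \<omega> - f \<omega>) + nrm T (v k \<omega> - g \<omega>)" for k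
        unfolding eq by (intro dist_le diff uv elim(1,3))
      have low: "0 \<le> nrm T (u k \<omega> - v k \<omega> - (f \<omega> - g \<omega>))" for k
        by (intro nrm_nonneg T order_refl diff uv elim(1,3))
      show ?case
        by (rule tendsto_sandwich[OF always_eventually[OF allI[OF low]] always_eventually[OF allI[OF up]]
              tendsto_const tendsto_add[OF elim(2,4), unfolded add_0]])
    qed
  qed
  show ?thesis
  proof (rule Bochner_Integration.integrable_bound)
    \<comment> \<open>The dominating function comes from the norm at time \<open>T\<close> and
      \<open>(a + b)\<^sup>2 \<le> 2 * a\<^sup>2 + 2 * b\<^sup>2\<close>.\<close>
    show "integrable P (\<lambda>\<omega>. 2 * (nrm T (f \<omega>))\<^sup>2 + 2 * (nrm T (g \<omega>))\<^sup>2)"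
      using fu(2) gv(2) by simp
    show "AE \<omega> in P. norm ((rnorm nrm res T (\<sigma> \<omega>) (f \<omega> - g \<omega>))\<^sup>2)
        \<le> norm (2 * (nrm T (f \<omega>))\<^sup>2 + 2 * (nrm T (g \<omega>))\<^sup>2)"
      using fu(1) gv(1) AE_space
    proof eventually_elim
      case (elim \<omega>)
      note \<sigma>\<omega> = \<sigma>(2)[OF elim(3), THEN conjunct1] \<sigma>(2)[OF elim(3), THEN conjunct2]
      let ?r = "rnorm nrm res T (\<sigma> \<omega>) (f \<omega> - g \<omega>)" and ?a = "nrm T (f \<omega>)" and ?b = "nrm T (g \<omega>)"
      have "?r \<le> nrm T (f \<omega> - g \<omega>)"
        unfolding rnorm_def by (intro nrm_res_le \<sigma>\<omega> order_refl diff elim(1,2))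
      also have "\<dots> \<le> ?a + ?b" by (intro dist_le elim(1,2))
      finally have "?r\<^sup>2 \<le> (?a + ?b)\<^sup>2"
        by (intro power_mono rnorm_nonneg \<sigma>\<omega> order_refl diff elim(1,2))
      also have "\<dots> \<le> 2 * ?a\<^sup>2 + 2 * ?b\<^sup>2"
        using sum_squares_bound[of ?a ?b] by (simp add: power2_sum)
      finally show ?case by simp
    qed
  qed measurable
qed

text \<open>Restriction to time 0 preserves convergence along the same subsequence. The stopped norm
  becomes constant in time and equals the old one at time 0, so it is measurable for
  \<open>F 0\<close>.\<close>

lemma limit_up_to_initial:
  assumes basis: "complete_filtered_prob_space P F" and T: "0 < T"
    and \<Psi>n: "\<And>n. AE \<omega> in P. \<Psi>n n \<omega> \<in> X T"
    and lim: "limit_up_to P F T X nrm res \<Psi>n \<tau> \<Psi> m"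
  shows "limit_up_to P F T X nrm res \<Psi>n (\<lambda>_. 0) (\<lambda>\<omega>. res (\<tau> \<omega>) 0 (\<Psi> \<omega>)) m"
proof -
  interpret filtration "space P" F using basis by (simp add: complete_filtered_prob_space_def)
  have \<tau>: "0 \<le> \<tau> \<omega>" "\<tau> \<omega> \<le> T" if "\<omega> \<in> space P" for \<omega>
    using lim that by (auto simp: limit_up_to_def nonneg_stopping_time_def)
  have \<Psi>: "AE \<omega> in P. \<Psi> \<omega> \<in> X (\<tau> \<omega>)" using lim by (simp add: limit_up_to_def)
  have 1: "nonneg_stopping_time P F (\<lambda>_. 0)"
    by (simp add: nonneg_stopping_time_def stopping_time_const)
  have 2: "AE \<omega> in P. res (\<tau> \<omega>) 0 (\<Psi> \<omega>) \<in> X 0"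
    using \<Psi> AE_space by eventually_elim (intro res_in \<tau> order_refl)
  have 3: "(\<lambda>\<omega>. rnorm nrm res 0 (min t 0) (res (\<tau> \<omega>) 0 (\<Psi> \<omega>))) \<in> borel_measurable (F t)" if t: "0 \<le> t" for t
  proof (rule borel_measurable_AE_cong[OF basis t])
    have "(\<lambda>\<omega>. rnorm nrm res (\<tau> \<omega>) (min 0 (\<tau> \<omega>)) (\<Psi> \<omega>)) \<in> borel_measurable (F 0)"
      using lim by (simp add: limit_up_to_def)
    then show "(\<lambda>\<omega>. rnorm nrm res (\<tau> \<omega>) (min 0 (\<tau> \<omega>)) (\<Psi> \<omega>)) \<in> borel_measurable (F t)"
      by (rule measurable_mono[OF order_refl refl sets_F_mono[OF t], THEN subsetD, rotated]) (simp add: space_F)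
    show "AE \<omega> in P. rnorm nrm res (\<tau> \<omega>) (min 0 (\<tau> \<omega>)) (\<Psi> \<omega>) = rnorm nrm res 0 (min t 0) (res (\<tau> \<omega>) 0 (\<Psi> \<omega>))"
      using 2 AE_space
    proof eventually_elim
      case (elim \<omega>)
      then show ?case using t T \<tau>[of \<omega>] by (simp add: rnorm_def res_refl)
    qed
  qed
  have "AE \<omega> in P. \<forall>n. \<Psi>n n \<omega> \<in> X T" using \<Psi>n by (simp add: AE_all_countable)
  moreover have "AE \<omega> in P. (\<lambda>j. nrm (\<tau> \<omega>) (\<Psi> \<omega> - res T (\<tau> \<omega>) (\<Psi>n (m j) \<omega>))) \<longlonglongrightarrow> 0"
    using lim by (simp add: limit_up_to_def)
  ultimately have 4: "AE \<omega> in P. (\<lambda>j. nrm 0 (res (\<tau> \<omega>) 0 (\<Psi> \<omega>) - res T 0 (\<Psi>n (m j) \<omega>))) \<longlonglongrightarrow> 0"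
    using \<Psi> AE_space
  proof eventually_elim
    case (elim \<omega>)
    show ?case
      by (rule restrict_limit[OF order_refl \<tau>(1)[OF elim(4)] \<tau>(2)[OF elim(4)] _ elim(3,2)]) (use elim(1) in simp)
  qed
  have "continuous_on {0..} (\<lambda>t. rnorm nrm res 0 (min t 0) (res (\<tau> \<omega>) 0 (\<Psi> \<omega>)))" for \<omega>
    by (rule continuous_on_eq[OF continuous_on_const[of _ "rnorm nrm res 0 0 (res (\<tau> \<omega>) 0 (\<Psi> \<omega>))"]]) (simp add: min_absorb2)
  moreover have "strict_mono m" using lim by (simp add: limit_up_to_def)
  ultimately show ?thesis
    unfolding limit_up_to_def using T by (intro conjI allI impI ballI AE_I2 1 2 3 4) simp_all
qed

end

section \<open>The limit process\<close>

locale cauchy_processes = banach_scale T X nrm res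
  for T :: real and X :: "real \<Rightarrow> 'a::real_vector set" and nrm :: "real \<Rightarrow> 'a \<Rightarrow> real"
    and res :: "real \<Rightarrow> real \<Rightarrow> 'a \<Rightarrow> 'a" +
  fixes P :: "'w measure" and F :: "real \<Rightarrow> 'w measure" and \<Psi>n :: "nat \<Rightarrow> 'w \<Rightarrow> 'a"
  assumes basis: "complete_filtered_prob_space P F"
    and T_pos: "T > 0"
    and adapted: "\<And>n t. 0 \<le> t \<Longrightarrow> t \<le> T \<Longrightarrow> (\<lambda>\<omega>. rnorm nrm res T t (\<Psi>n n \<omega>)) \<in> borel_measurable (F t)"
    and cont: "\<And>n. AE \<omega> in P. continuous_on {0..T} (\<lambda>t. rnorm nrm res T t (\<Psi>n n \<omega>))"
    and L2: "\<And>n. bochner_L2 P (X T) (nrm T) (\<Psi>n n)"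
    and init: "esssup P (\<lambda>\<omega>. SUP n. ereal (rnorm nrm res T 0 (\<Psi>n n \<omega>))) < \<infinity>"
    and cauchy: "\<And>M. M > 1 \<Longrightarrow>
       (\<lambda>m. SUP n\<in>{m..}. ereal (\<integral>\<omega>. (rnorm nrm res T
              (min (hit_time T nrm res \<Psi>n M m \<omega>) (hit_time T nrm res \<Psi>n M n \<omega>))
              (\<Psi>n n \<omega> - \<Psi>n m \<omega>))\<^sup>2 \<partial>P)) \<longlonglongrightarrow> 0"
begin

sublocale complete_measure P using basis by (simp add: complete_filtered_prob_space_def)
sublocale prob_space P using basis by (simp add: complete_filtered_prob_space_def)
sublocale filtration "space P" F using basis by (simp add: complete_filtered_prob_space_def)

lemma borel_measurable_F_mono: "s \<le> t \<Longrightarrow> f \<in> borel_measurable (F s) \<Longrightarrow> f \<in> borel_measurable (F t)"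
  by (rule measurable_mono[OF order_refl refl sets_F_mono, THEN subsetD]) (simp_all add: space_F)

lemma measurable_stopping: "nonneg_stopping_time P F \<tau> \<Longrightarrow> \<tau> \<in> borel_measurable P"
  using basis by (intro measurable_stopping_time[of F])
    (auto simp: nonneg_stopping_time_def complete_filtered_prob_space_def space_F)

lemma AE_in_X: "AE \<omega> in P. \<forall>n. \<Psi>n n \<omega> \<in> X T"
  using L2 by (simp add: AE_all_countable bochner_L2_def)

lemma AE_cont: "AE \<omega> in P. \<forall>n. continuous_on {0..T} (\<lambda>t. rnorm nrm res T t (\<Psi>n n \<omega>))"
  using cont by (simp add: AE_all_countable)

lemma AE_initial_bound:
  obtains K where "AE \<omega> in P. \<forall>n. rnorm nrm res T 0 (\<Psi>n n \<omega>) \<le> K"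
proof -
  have "\<exists>K. e \<le> ereal K" if "e < \<infinity>" for e using that by (cases e) auto
  from this[OF init] obtain K where K: "esssup P (\<lambda>\<omega>. SUP n. ereal (rnorm nrm res T 0 (\<Psi>n n \<omega>))) \<le> ereal K" ..
  have "AE \<omega> in P. \<forall>n. rnorm nrm res T 0 (\<Psi>n n \<omega>) \<le> K"
    using esssup_AE[of "\<lambda>\<omega>. SUP n. ereal (rnorm nrm res T 0 (\<Psi>n n \<omega>))" P]
  proof eventually_elim
    case (elim \<omega>)
    have "ereal (rnorm nrm res T 0 (\<Psi>n n \<omega>)) \<le> ereal K" for n
      by (rule order_trans[OF SUP_upper[OF UNIV_I] order_trans[OF elim K]])
    then show ?case by simp
  qed
  then show thesis by (rule that)
qed

lemma hit_time_stopping: "nonneg_stopping_time P F (hit_time T nrm res \<Psi>n M n)"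
proof -
  let ?A = "\<lambda>s \<omega>. s \<le> T \<and> M + (rnorm nrm res T 0 (\<Psi>n n \<omega>))\<^sup>2 \<le> (rnorm nrm res T s (\<Psi>n n \<omega>))\<^sup>2"
  have "nonneg_stopping_time P F (\<lambda>\<omega>. capped_inf T {s. 0 \<le> s \<and> ?A s \<omega>})"
  proof (rule nonneg_stopping_time_capped_inf[OF basis T_pos])
    show "AE \<omega> in P. \<forall>s u. 0 \<le> s \<longrightarrow> s \<le> u \<longrightarrow> u \<le> T \<longrightarrow> ?A s \<omega> \<longrightarrow> ?A u \<omega>"
      using AE_in_X
    proof eventually_elim
      case (elim \<omega>)
      have "(rnorm nrm res T s (\<Psi>n n \<omega>))\<^sup>2 \<le> (rnorm nrm res T u (\<Psi>n n \<omega>))\<^sup>2" if "0 \<le> s" "s \<le> u" "u \<le> T" for s u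
        using that elim by (intro power_mono rnorm_mono rnorm_nonneg) auto
      then show ?case by (meson order_trans)
    qed
    show "AE \<omega> in P. \<forall>t. 0 \<le> t \<longrightarrow> t < T \<longrightarrow> (\<forall>s. t < s \<longrightarrow> s \<le> T \<longrightarrow> ?A s \<omega>) \<longrightarrow> ?A t \<omega>"
      using cont[of n]
    proof eventually_elim
      case (elim \<omega>)
      then have "continuous_on {0..T} (\<lambda>t. (rnorm nrm res T t (\<Psi>n n \<omega>))\<^sup>2)" by (rule continuous_on_power)
      from continuous_on_right_ge[OF this] show ?case by (meson less_imp_le)
    qed
    fix t assume t: "0 \<le> t" "t < T"
    have [measurable]: "(\<lambda>\<omega>. rnorm nrm res T t (\<Psi>n n \<omega>)) \<in> borel_measurable (F t)"
      "(\<lambda>\<omega>. rnorm nrm res T 0 (\<Psi>n n \<omega>)) \<in> borel_measurable (F t)"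
      using adapted[of t n] borel_measurable_F_mono[OF t(1) adapted[of 0 n]] t by auto
    show "Measurable.pred (F t) (?A t)" by measurable
  qed
  then show ?thesis by (simp add: hit_time_def[abs_def])
qed

lemma hit_time_bounds: "0 \<le> hit_time T nrm res \<Psi>n M n \<omega>" "hit_time T nrm res \<Psi>n M n \<omega> \<le> T"
  unfolding hit_time_def using T_pos by (auto intro!: capped_inf_nonneg capped_inf_lower)

lemma fast_subsequence:
  assumes M: "M > 1"
  obtains m where "strict_mono m"
    "AE \<omega> in P. \<forall>\<^sub>F j in sequentially.
       rnorm nrm res T (min (hit_time T nrm res \<Psi>n M (m j) \<omega>) (hit_time T nrm res \<Psi>n M (m (Suc j)) \<omega>))
         (\<Psi>n (m (Suc j)) \<omega> - \<Psi>n (m j) \<omega>) \<le> (1/2)^j"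
proof -
  let ?d = "\<lambda>m n \<omega>. rnorm nrm res T (min (hit_time T nrm res \<Psi>n M m \<omega>) (hit_time T nrm res \<Psi>n M n \<omega>))
      (\<Psi>n n \<omega> - \<Psi>n m \<omega>)"
  define S where "S m = (SUP n\<in>{m..}. ereal (\<integral>\<omega>. (?d m n \<omega>)\<^sup>2 \<partial>P))" for m
  have "S \<longlonglongrightarrow> 0" unfolding S_def by (rule cauchy[OF M])
  then have "\<forall>\<^sub>F n in sequentially. S n < ereal ((1/8)^j)" for j
    by (rule order_tendstoD) simp
  from strict_mono_subsequence[of "\<lambda>j n. S n < ereal ((1/8)^j)", OF this]
  obtain m where m: "strict_mono m" "\<And>j. S (m j) < ereal ((1/8)^j)" by blast
  have "AE \<omega> in P. \<forall>\<^sub>F j in sequentially. ?d (m j) (m (Suc j)) \<omega> \<le> (1/2)^j"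
  proof (rule AE_eventually_le_half_power)
    show "prob_space P" using basis by (simp add: complete_filtered_prob_space_def)
    fix j
    have meas: "(\<lambda>\<omega>. min (hit_time T nrm res \<Psi>n M (m j) \<omega>) (hit_time T nrm res \<Psi>n M (m (Suc j)) \<omega>)) \<in> borel_measurable P"
      by (intro borel_measurable_min measurable_stopping hit_time_stopping)
    show "integrable P (\<lambda>\<omega>. (?d (m j) (m (Suc j)) \<omega>)\<^sup>2)"
      by (rule integrable_rnorm_diff[OF complete_measure_axioms less_imp_le[OF T_pos] L2 L2 meas])
        (simp add: hit_time_bounds min.coboundedI1)
    \<comment> \<open>The next index is among those over which \<open>S (m j)\<close> is a supremum,
      so smallness of \<open>S (m j)\<close> controls consecutive differences.\<close>
    have "m (Suc j) \<in> {m j..}" using m(1) by (simp add: strict_mono_leD)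
    then have "ereal (\<integral>\<omega>. (?d (m j) (m (Suc j)) \<omega>)\<^sup>2 \<partial>P) \<le> S (m j)"
      unfolding S_def by (rule SUP_upper)
    then have "ereal (\<integral>\<omega>. (?d (m j) (m (Suc j)) \<omega>)\<^sup>2 \<partial>P) < ereal ((1/8)^j)"
      using m(2) by (rule le_less_trans)
    then show "(\<integral>\<omega>. (?d (m j) (m (Suc j)) \<omega>)\<^sup>2 \<partial>P) \<le> (1/8)^j" by simp
  qed
  then show thesis by (rule that[OF m(1)])
qed

text \<open>The last conclusion is the dichotomy at \<open>\<tau>\<close> that later puts the
  hitting time of level \<open>M - 1\<close> by the limit below \<open>\<tau>\<close>.\<close>

lemma limit_process:
  assumes M: "M > 1"
  obtains \<tau> \<Psi> m where "limit_up_to P F T X nrm res \<Psi>n \<tau> \<Psi> m"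
    "AE \<omega> in P. \<forall>\<^sub>F j in sequentially. \<tau> \<omega> \<le> hit_time T nrm res \<Psi>n M (m j) \<omega>"
    "AE \<omega> in P. \<tau> \<omega> = T \<or> M - 1 \<le> (rnorm nrm res (\<tau> \<omega>) (\<tau> \<omega>) (\<Psi> \<omega>))\<^sup>2"
proof -
  obtain K where K: "AE \<omega> in P. \<forall>n. rnorm nrm res T 0 (\<Psi>n n \<omega>) \<le> K" by (rule AE_initial_bound)
  obtain m where m: "strict_mono m"
    "AE \<omega> in P. \<forall>\<^sub>F j in sequentially.
       rnorm nrm res T (min (hit_time T nrm res \<Psi>n M (m j) \<omega>) (hit_time T nrm res \<Psi>n M (m (Suc j)) \<omega>))
         (\<Psi>n (m (Suc j)) \<omega> - \<Psi>n (m j) \<omega>) \<le> (1/2)^j"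
    using M by (rule fast_subsequence)
  define A where "A s \<omega> \<longleftrightarrow> s \<le> T \<and> ereal (M - 1) \<le>
    liminf (\<lambda>j. ereal ((rnorm nrm res T s (\<Psi>n (m j) \<omega>))\<^sup>2 - (rnorm nrm res T 0 (\<Psi>n (m j) \<omega>))\<^sup>2))" for s \<omega>
  define \<tau> where "\<tau> \<omega> = capped_inf T {s. 0 \<le> s \<and> A s \<omega>}" for \<omega>
  \<comment> \<open>The limit is chosen separately for each \<open>\<omega>\<close>. Only its norms
    have to be measurable, and these are determined by the norms along the subsequence.\<close>
  define \<Psi> where "\<Psi> \<omega> = (SOME y. y \<in> X (\<tau> \<omega>) \<and> (\<lambda>j. nrm (\<tau> \<omega>) (y - res T (\<tau> \<omega>) (\<Psi>n (m j) \<omega>))) \<longlonglongrightarrow> 0)" for \<omega>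
  have \<tau>_bounds: "0 \<le> \<tau> \<omega>" "\<tau> \<omega> \<le> T" for \<omega>
    unfolding \<tau>_def using T_pos by (auto intro!: capped_inf_nonneg capped_inf_lower)
  have paths: "AE \<omega> in P. (\<forall>s u. 0 \<le> s \<longrightarrow> s \<le> u \<longrightarrow> u \<le> T \<longrightarrow> A s \<omega> \<longrightarrow> A u \<omega>)
    \<and> (\<forall>t. 0 \<le> t \<longrightarrow> t < T \<longrightarrow> (\<forall>s. t < s \<longrightarrow> s \<le> T \<longrightarrow> A s \<omega>) \<longrightarrow> A t \<omega>)
    \<and> (\<forall>\<^sub>F j in sequentially. \<tau> \<omega> \<le> hit_time T nrm res \<Psi>n M (m j) \<omega>)
    \<and> \<Psi> \<omega> \<in> X (\<tau> \<omega>)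
    \<and> (\<lambda>j. nrm (\<tau> \<omega>) (\<Psi> \<omega> - res T (\<tau> \<omega>) (\<Psi>n (m j) \<omega>))) \<longlonglongrightarrow> 0
    \<and> (\<tau> \<omega> = T \<or> M - 1 \<le> (rnorm nrm res (\<tau> \<omega>) (\<tau> \<omega>) (\<Psi> \<omega>))\<^sup>2)"
    using AE_in_X AE_cont K m(2)
  proof eventually_elim
    case (elim \<omega>)
    obtain J where J: "\<forall>j\<ge>J.
       rnorm nrm res T (min (hit_time T nrm res \<Psi>n M (m j) \<omega>) (hit_time T nrm res \<Psi>n M (m (Suc j)) \<omega>))
         (\<Psi>n (m (Suc j)) \<omega> - \<Psi>n (m j) \<omega>) \<le> (1/2)^j"
      using elim(4) unfolding eventually_sequentially by blast
    note path = pathwise_limit[where x="\<lambda>j. \<Psi>n (m j) \<omega>" and A="\<lambda>s. A s \<omega>" and \<tau>="\<tau> \<omega>",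
        OF T_pos M elim(1)[THEN spec] elim(2)[THEN spec] elim(3)[THEN spec] hit_time_def J A_def \<tau>_def]
    have ex: "\<exists>y. y \<in> X (\<tau> \<omega>) \<and> (\<lambda>j. nrm (\<tau> \<omega>) (y - res T (\<tau> \<omega>) (\<Psi>n (m j) \<omega>))) \<longlonglongrightarrow> 0"
      using path(4) by blast
    note \<Psi> = someI_ex[OF ex, folded \<Psi>_def]
    show ?case
      using path(1) path(2) path(3) \<Psi> path(5)[OF \<Psi>[THEN conjunct1] \<Psi>[THEN conjunct2]] by blast
  qed
  have stop: "nonneg_stopping_time P F \<tau>"
    unfolding \<tau>_def
  proof (rule nonneg_stopping_time_capped_inf[OF basis T_pos])
    fix t assume t: "0 \<le> t" "t < T"
    have [measurable]: "(\<lambda>\<omega>. rnorm nrm res T t (\<Psi>n n \<omega>)) \<in> borel_measurable (F t)"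
      "(\<lambda>\<omega>. rnorm nrm res T 0 (\<Psi>n n \<omega>)) \<in> borel_measurable (F t)" for n
      using adapted[of t n] borel_measurable_F_mono[OF t(1) adapted[of 0 n]] t by auto
    show "Measurable.pred (F t) (A t)" unfolding A_def by measurable
  qed (use paths in \<open>eventually_elim, blast\<close>)+
  have \<Psi>_in: "AE \<omega> in P. \<Psi> \<omega> \<in> X (\<tau> \<omega>)" using paths by eventually_elim blast
  have \<Psi>_lim: "AE \<omega> in P. (\<lambda>j. nrm (\<tau> \<omega>) (\<Psi> \<omega> - res T (\<tau> \<omega>) (\<Psi>n (m j) \<omega>))) \<longlonglongrightarrow> 0"
    using paths by eventually_elim blast
  have \<Psi>_cont: "AE \<omega> in P. continuous_on {0..\<tau> \<omega>} (\<lambda>s. rnorm nrm res (\<tau> \<omega>) s (\<Psi> \<omega>))"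
    using AE_in_X AE_cont \<Psi>_in \<Psi>_lim
  proof eventually_elim
    case (elim \<omega>)
    show ?case
      by (rule continuous_rnorm_limit[OF \<tau>_bounds elim(1)[THEN spec] elim(3,4) elim(2)[THEN spec]])
  qed
  \<comment> \<open>The adapted substitute \<open>g\<close> is the limit of the norms along the
    subsequence, which equals the norm of \<open>\<Psi>\<close> up to \<open>\<tau>\<close>. Where
    the sequence diverges \<open>lim\<close> is arbitrary, but no equality is claimed beyond
    \<open>\<tau>\<close>; \<open>min s T\<close> keeps the time in the range where the norms are
    adapted.\<close>
  have meas: "(\<lambda>\<omega>. rnorm nrm res (\<tau> \<omega>) (min t (\<tau> \<omega>)) (\<Psi> \<omega>)) \<in> borel_measurable (F t)" if t: "0 \<le> t" for t
  proof (rule measurable_stopped_monotone[where f="\<lambda>s \<omega>. rnorm nrm res (\<tau> \<omega>) s (\<Psi> \<omega>)"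
        and g="\<lambda>s \<omega>. lim (\<lambda>j. rnorm nrm res T (min s T) (\<Psi>n (m j) \<omega>))", OF basis stop t _ \<Psi>_cont])
    show "AE \<omega> in P. \<forall>s u. 0 \<le> s \<longrightarrow> s \<le> u \<longrightarrow> u \<le> \<tau> \<omega> \<longrightarrow>
        rnorm nrm res (\<tau> \<omega>) s (\<Psi> \<omega>) \<le> rnorm nrm res (\<tau> \<omega>) u (\<Psi> \<omega>)"
      using \<Psi>_in by eventually_elim (intro allI impI rnorm_mono \<tau>_bounds)
    show "(\<lambda>\<omega>. lim (\<lambda>j. rnorm nrm res T (min s T) (\<Psi>n (m j) \<omega>))) \<in> borel_measurable (F s)" if "0 \<le> s" for s
      using that T_pos by (intro borel_measurable_lim_metric borel_measurable_F_mono[OF _ adapted, of "min s T"]) auto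
    show "AE \<omega> in P. \<forall>s. 0 \<le> s \<longrightarrow> s \<le> t \<longrightarrow> s \<le> \<tau> \<omega> \<longrightarrow>
        rnorm nrm res (\<tau> \<omega>) s (\<Psi> \<omega>) = lim (\<lambda>j. rnorm nrm res T (min s T) (\<Psi>n (m j) \<omega>))"
      using AE_in_X \<Psi>_in \<Psi>_lim
    proof eventually_elim
      case (elim \<omega>)
      have "lim (\<lambda>j. rnorm nrm res T (min s T) (\<Psi>n (m j) \<omega>)) = rnorm nrm res (\<tau> \<omega>) s (\<Psi> \<omega>)"
        if s: "0 \<le> s" "s \<le> \<tau> \<omega>" for s
      proof -
        have "min s T = s" using s(2) \<tau>_bounds(2)[of \<omega>] by simp
        then show ?thesis
          using limI[OF rnorm_limit[OF s \<tau>_bounds(2) elim(1)[THEN spec] elim(2,3)]] by simp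
      qed
      then show ?case by simp
    qed
  qed
  have cont': "AE \<omega> in P. continuous_on {0..} (\<lambda>t. rnorm nrm res (\<tau> \<omega>) (min t (\<tau> \<omega>)) (\<Psi> \<omega>))"
    using \<Psi>_cont
  proof eventually_elim
    case (elim \<omega>)
    show ?case
      by (rule continuous_on_compose2[OF elim, of "{0..}" "\<lambda>t. min t (\<tau> \<omega>)"])
        (use \<tau>_bounds[of \<omega>] in \<open>auto intro!: continuous_intros\<close>)
  qed
  show thesis
  proof (rule that[of \<tau> \<Psi> m])
    show "limit_up_to P F T X nrm res \<Psi>n \<tau> \<Psi> m"
      unfolding limit_up_to_def
      by (intro conjI stop ballI allI impI \<tau>_bounds \<Psi>_in meas cont' m(1) \<Psi>_lim)
  qed (use paths in \<open>eventually_elim, blast\<close>)+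
qed

end

section \<open>Hitting times of the limit process\<close>

context banach_scale
begin

lemma hitting_limit_stopping_time:
  assumes basis: "complete_filtered_prob_space P F" and T: "0 < T"
    and lim: "limit_up_to P F T X nrm res \<Psi>n \<tau> \<Psi> m"
  shows "nonneg_stopping_time P F (\<lambda>\<omega>. capped_inf T
    {s. 0 \<le> s \<and> R \<le> (rnorm nrm res (\<tau> \<omega>) (min s (\<tau> \<omega>)) (\<Psi> \<omega>))\<^sup>2})"
proof (rule nonneg_stopping_time_capped_inf[OF basis T])
  have \<tau>: "0 \<le> \<tau> \<omega>" "\<tau> \<omega> \<le> T" if "\<omega> \<in> space P" for \<omega>
    using lim that by (auto simp: limit_up_to_def nonneg_stopping_time_def)
  have \<Psi>: "AE \<omega> in P. \<Psi> \<omega> \<in> X (\<tau> \<omega>)" using lim by (simp add: limit_up_to_def)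
  then show "AE \<omega> in P. \<forall>s u. 0 \<le> s \<longrightarrow> s \<le> u \<longrightarrow> u \<le> T \<longrightarrow>
      R \<le> (rnorm nrm res (\<tau> \<omega>) (min s (\<tau> \<omega>)) (\<Psi> \<omega>))\<^sup>2 \<longrightarrow> R \<le> (rnorm nrm res (\<tau> \<omega>) (min u (\<tau> \<omega>)) (\<Psi> \<omega>))\<^sup>2"
    using AE_space
  proof eventually_elim
    case (elim \<omega>)
    have "(rnorm nrm res (\<tau> \<omega>) (min s (\<tau> \<omega>)) (\<Psi> \<omega>))\<^sup>2 \<le> (rnorm nrm res (\<tau> \<omega>) (min u (\<tau> \<omega>)) (\<Psi> \<omega>))\<^sup>2"
      if "0 \<le> s" "s \<le> u" for s u
      using that elim(1) \<tau>[OF elim(2)] by (intro power_mono rnorm_mono rnorm_nonneg) auto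
    then show ?case by (meson order_trans)
  qed
  have "AE \<omega> in P. continuous_on {0..} (\<lambda>t. rnorm nrm res (\<tau> \<omega>) (min t (\<tau> \<omega>)) (\<Psi> \<omega>))"
    using lim by (simp add: limit_up_to_def)
  then show "AE \<omega> in P. \<forall>t. 0 \<le> t \<longrightarrow> t < T \<longrightarrow>
      (\<forall>s. t < s \<longrightarrow> s \<le> T \<longrightarrow> R \<le> (rnorm nrm res (\<tau> \<omega>) (min s (\<tau> \<omega>)) (\<Psi> \<omega>))\<^sup>2) \<longrightarrow>
      R \<le> (rnorm nrm res (\<tau> \<omega>) (min t (\<tau> \<omega>)) (\<Psi> \<omega>))\<^sup>2"
  proof eventually_elim
    case (elim \<omega>)
    have "continuous_on {0..T} (\<lambda>t. (rnorm nrm res (\<tau> \<omega>) (min t (\<tau> \<omega>)) (\<Psi> \<omega>))\<^sup>2)"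
      by (intro continuous_on_power continuous_on_subset[OF elim]) auto
    from continuous_on_right_ge[OF this] show ?case by meson
  qed
  fix t :: real assume t: "0 \<le> t"
  have [measurable]: "(\<lambda>\<omega>. rnorm nrm res (\<tau> \<omega>) (min t (\<tau> \<omega>)) (\<Psi> \<omega>)) \<in> borel_measurable (F t)"
    using lim t by (simp add: limit_up_to_def)
  show "Measurable.pred (F t) (\<lambda>\<omega>. R \<le> (rnorm nrm res (\<tau> \<omega>) (min t (\<tau> \<omega>)) (\<Psi> \<omega>))\<^sup>2)" by measurable
qed

end

lemma capped_inf_stopped_le:
  assumes \<tau>: "0 \<le> \<tau>" and hit: "\<tau> = T \<or> R \<le> f \<tau>"
  shows "capped_inf T {s. 0 \<le> s \<and> R \<le> f (min s \<tau>)} \<le> \<tau>"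
  using assms by (intro capped_inf_lower) auto

text \<open>After \<open>\<tau>\<close> the stopped path is constant, so a level attained later is
  already attained at \<open>\<tau>\<close>.\<close>

lemma capped_inf_stopped:
  assumes T: "0 \<le> T" and \<tau>: "0 \<le> \<tau>"
  shows "capped_inf T {s. 0 \<le> s \<and> R \<le> f (min s \<tau>)} = capped_inf T {s. 0 \<le> s \<and> s \<le> \<tau> \<and> R \<le> f s}"
    (is "capped_inf T ?A = capped_inf T ?B")
proof (rule antisym)
  show "capped_inf T ?A \<le> capped_inf T ?B"
    unfolding capped_inf_def
    by (rule cInf_superset_mono) (use T in \<open>auto intro!: bdd_belowI[of _ 0] simp: min_absorb1\<close>)
  have "capped_inf T ?B \<le> s" if s: "s \<in> insert T ?A" for s
  proof (cases "s = T \<or> s \<le> \<tau>")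
    case True
    then show ?thesis using s by (intro capped_inf_lower) (auto simp: min_absorb1)
  next
    case False
    then have "\<tau> \<in> ?B" using s \<tau> by (auto simp: min_absorb2)
    then have "capped_inf T ?B \<le> \<tau>" by (intro capped_inf_lower) auto
    then show ?thesis using False by simp
  qed
  then show "capped_inf T ?B \<le> capped_inf T ?A"
    unfolding capped_inf_def[of T ?A] by (intro cInf_greatest) auto
qed

text \<open>The two conjuncts have separate witnesses: comparison with the hitting times for every
  \<open>j\<close> comes first, and comparison for large \<open>j\<close> goes with the choice of
  \<open>M\<close> for a level \<open>R\<close>, in accordance with the example after
  \<open>limit_up_to\<close>. In the second, the limits are fixed as functions of \<open>M\<close>
  before \<open>R\<close> is given.\<close>

theorem lemma3p4p1:
  fixes P :: "'w measure" and F :: "real \<Rightarrow> 'w measure" and T :: real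
    and X :: "real \<Rightarrow> 'a::real_vector set" and nrm :: "real \<Rightarrow> 'a \<Rightarrow> real"
    and res :: "real \<Rightarrow> real \<Rightarrow> 'a \<Rightarrow> 'a"
    and \<Psi>n :: "nat \<Rightarrow> 'w \<Rightarrow> 'a"
  assumes basis: "complete_filtered_prob_space P F"
    and T_pos: "T > 0"
    and scale: "banach_scale T X nrm res"
    and adapted: "\<And>n t. 0 \<le> t \<Longrightarrow> t \<le> T \<Longrightarrow> (\<lambda>\<omega>. rnorm nrm res T t (\<Psi>n n \<omega>)) \<in> borel_measurable (F t)"
    and cont: "\<And>n. AE \<omega> in P. continuous_on {0..T} (\<lambda>t. rnorm nrm res T t (\<Psi>n n \<omega>))"
    and L2: "\<And>n. bochner_L2 P (X T) (nrm T) (\<Psi>n n)"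
    and init: "esssup P (\<lambda>\<omega>. SUP n. ereal (rnorm nrm res T 0 (\<Psi>n n \<omega>))) < \<infinity>"
    and cauchy: "\<And>M. M > 1 \<Longrightarrow>
       (\<lambda>m. SUP n\<in>{m..}. ereal (\<integral>\<omega>. (rnorm nrm res T
              (min (hit_time T nrm res \<Psi>n M m \<omega>) (hit_time T nrm res \<Psi>n M n \<omega>))
              (\<Psi>n n \<omega> - \<Psi>n m \<omega>))\<^sup>2 \<partial>P)) \<longlonglongrightarrow> 0"
    and equicont: "\<And>M \<gamma> \<delta>. M > 1 \<Longrightarrow> nonneg_stopping_time P F \<gamma> \<Longrightarrow>
       (\<And>j. nonneg_stopping_time P F (\<delta> j)) \<Longrightarrow> (AE \<omega> in P. (\<lambda>j. \<delta> j \<omega>) \<longlonglongrightarrow> 0) \<Longrightarrow>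
       (\<lambda>j::nat. SUP n. ereal (\<integral>\<omega>.
            ((rnorm nrm res T (min (\<gamma> \<omega> + \<delta> j \<omega>) (hit_time T nrm res \<Psi>n M n \<omega>)) (\<Psi>n n \<omega>))\<^sup>2
           - (rnorm nrm res T (min (\<gamma> \<omega>) (hit_time T nrm res \<Psi>n M n \<omega>)) (\<Psi>n n \<omega>))\<^sup>2) \<partial>P)) \<longlonglongrightarrow> 0"
  shows
    "(\<forall>M>1. \<exists>\<tau> \<Psi> m. limit_up_to P F T X nrm res \<Psi>n \<tau> \<Psi> m
        \<and> (\<forall>j. AE \<omega> in P. \<tau> \<omega> \<le> hit_time T nrm res \<Psi>n M (m j) \<omega>))
   \<and> (\<exists>(\<tau> :: real \<Rightarrow> 'w \<Rightarrow> real) (\<Psi> :: real \<Rightarrow> 'w \<Rightarrow> 'a) (m :: real \<Rightarrow> nat \<Rightarrow> nat).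
        (\<forall>M>1. limit_up_to P F T X nrm res \<Psi>n (\<tau> M) (\<Psi> M) (m M)
           \<and> (AE \<omega> in P. \<forall>\<^sub>F j in sequentially. \<tau> M \<omega> \<le> hit_time T nrm res \<Psi>n M (m M j) \<omega>))
      \<and> (\<forall>R>0. \<exists>M>1.
           let \<tau>R = (\<lambda>\<omega>. capped_inf T
                 {s. 0 \<le> s \<and> (rnorm nrm res (\<tau> M \<omega>) (min s (\<tau> M \<omega>)) (\<Psi> M \<omega>))\<^sup>2 \<ge> R})
           in nonneg_stopping_time P F \<tau>R
            \<and> (AE \<omega> in P. \<tau>R \<omega> \<le> \<tau> M \<omega>)
            \<and> (AE \<omega> in P. \<tau>R \<omega> = capped_inf T
                 {s. 0 \<le> s \<and> s \<le> \<tau> M \<omega> \<and> (rnorm nrm res (\<tau> M \<omega>) s (\<Psi> M \<omega>))\<^sup>2 \<ge> R})))"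
proof -
  interpret banach_scale T X nrm res by (rule scale)
  interpret cauchy_processes T X nrm res P F \<Psi>n
    using basis T_pos adapted cont L2 init cauchy by unfold_locales
  let ?hit = "hit_time T nrm res \<Psi>n"
  \<comment> \<open>The third clause does not occur in the conclusion; it is kept through the choice
    of witnesses because it locates the hitting time of \<open>R\<close>.\<close>
  define good where "good M \<tau> \<Psi> m \<longleftrightarrow> limit_up_to P F T X nrm res \<Psi>n \<tau> \<Psi> m
      \<and> (AE \<omega> in P. \<forall>\<^sub>F j in sequentially. \<tau> \<omega> \<le> ?hit M (m j) \<omega>)
      \<and> (AE \<omega> in P. \<tau> \<omega> = T \<or> M - 1 \<le> (rnorm nrm res (\<tau> \<omega>) (\<tau> \<omega>) (\<Psi> \<omega>))\<^sup>2)" for M \<tau> \<Psi> m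
  have "\<exists>\<tau> \<Psi> m. good M \<tau> \<Psi> m" if "M > 1" for M
    unfolding good_def by (rule limit_process[OF that]) (intro exI conjI)
  then obtain \<tau> \<Psi> m where "\<And>M. M > 1 \<Longrightarrow> good M (\<tau> M) (\<Psi> M) (m M)" by metis
  note p = this[unfolded good_def, THEN conjunct1] this[unfolded good_def, THEN conjunct2, THEN conjunct1]
    this[unfolded good_def, THEN conjunct2, THEN conjunct2]
  have AE_X: "AE \<omega> in P. \<Psi>n n \<omega> \<in> X T" for n
    using AE_in_X by eventually_elim (rule spec)
  have "\<exists>\<tau> \<Psi> m. limit_up_to P F T X nrm res \<Psi>n \<tau> \<Psi> m \<and> (\<forall>j. AE \<omega> in P. \<tau> \<omega> \<le> ?hit M (m j) \<omega>)"
    if M: "M > 1" for M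
  proof (intro exI conjI allI)
    \<comment> \<open>The first part puts no lower bound on the stopping time, so \<open>0\<close> is admissible.\<close>
    show "limit_up_to P F T X nrm res \<Psi>n (\<lambda>_. 0) (\<lambda>\<omega>. res (\<tau> M \<omega>) 0 (\<Psi> M \<omega>)) (m M)"
      by (rule limit_up_to_initial[OF basis T_pos AE_X p(1)[OF M]])
    show "AE \<omega> in P. 0 \<le> ?hit M (m M j) \<omega>" for j
      by (simp add: hit_time_bounds)
  qed
  moreover have "\<exists>M>1.
           let \<tau>R = (\<lambda>\<omega>. capped_inf T
                 {s. 0 \<le> s \<and> (rnorm nrm res (\<tau> M \<omega>) (min s (\<tau> M \<omega>)) (\<Psi> M \<omega>))\<^sup>2 \<ge> R})
           in nonneg_stopping_time P F \<tau>R
            \<and> (AE \<omega> in P. \<tau>R \<omega> \<le> \<tau> M \<omega>)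
            \<and> (AE \<omega> in P. \<tau>R \<omega> = capped_inf T
                 {s. 0 \<le> s \<and> s \<le> \<tau> M \<omega> \<and> (rnorm nrm res (\<tau> M \<omega>) s (\<Psi> M \<omega>))\<^sup>2 \<ge> R})"
    if "R > 0" for R
  proof -
    have M: "1 < R + 1" using that by simp
    have \<tau>: "AE \<omega> in P. 0 \<le> \<tau> (R + 1) \<omega>"
      using p(1)[OF M] by (intro AE_I2) (simp add: limit_up_to_def nonneg_stopping_time_def)
    define f where "f \<omega> s = (rnorm nrm res (\<tau> (R + 1) \<omega>) s (\<Psi> (R + 1) \<omega>))\<^sup>2" for \<omega> s
    have "nonneg_stopping_time P F (\<lambda>\<omega>. capped_inf T {s. 0 \<le> s \<and> R \<le> f \<omega> (min s (\<tau> (R + 1) \<omega>))})"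
      unfolding f_def by (rule hitting_limit_stopping_time[OF basis T_pos p(1)[OF M]])
    \<comment> \<open>For \<open>M = R + 1\<close> the dichotomy reads: \<open>\<tau>\<close> equals
      the cap \<open>T\<close>, or level \<open>R\<close> is reached at
      \<open>\<tau>\<close>.\<close>
    moreover have "AE \<omega> in P. capped_inf T {s. 0 \<le> s \<and> R \<le> f \<omega> (min s (\<tau> (R + 1) \<omega>))} \<le> \<tau> (R + 1) \<omega>"
      using \<tau> p(3)[OF M] by eventually_elim (rule capped_inf_stopped_le, simp_all add: f_def)
    moreover have "AE \<omega> in P. capped_inf T {s. 0 \<le> s \<and> R \<le> f \<omega> (min s (\<tau> (R + 1) \<omega>))}
        = capped_inf T {s. 0 \<le> s \<and> s \<le> \<tau> (R + 1) \<omega> \<and> R \<le> f \<omega> s}"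
      using \<tau> by eventually_elim (rule capped_inf_stopped[OF less_imp_le[OF T_pos]])
    ultimately show ?thesis
      unfolding Let_def f_def using M by (intro exI[of _ "R + 1"] conjI)
  qed
  ultimately show ?thesis
    using p(1,2) by (intro conjI allI impI exI[of _ \<tau>] exI[of _ \<Psi>] exI[of _ m])
qed

end
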